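(* Let $n\ge 1$ and let $I = I(C_{2n+1})\subseteq K[x_1,\ldots,x_{2n+1}]$ be the edge ideal of the odd cycle $C_{2n+1}$. Then for every integer $t$ satisfying $n+2\le t\le 2n+1$, $$\operatorname{sdefect}(I,t) = \left(\!\binom{2n+1}{t-n-1}\!\right),$$ where $\left(\!\binom{a}{b}\!\right) = \binom{a+b-1}{b}$ denotes the multichoose number, i.e. the number of multisets of size $b$ with elements from a set of size $a$.
   Context: $K$ is an algebraically closed field. $C_{2n+1}$ is the cycle graph with vertices $x_1,\ldots,x_{2n+1}$ and edges $\{x_j,x_{j+1}\}$ for $1\le j\le 2n$ and $\{x_{2n+1},x_1\}$. The edge ideal $I(G)$ of a simple graph $G$ on the variables is the ideal generated by all products $x_ix_j$ with $\{x_i,x_j\}$ an edge of $G$. The $m$th symbolic power of an ideal $I$ of a polynomial ring $S$ is $I^{(m)} = S\cap\bigcap_{P\in \mathrm{Ass}(I)} I^m S_P$. The symbolic defect $\operatorname{sdefect}(I,m)$ of a homogeneous ideal $I$ is the number of minimal generators of the $S$-module $I^{(m)}/I^m$, i.e. the minimal number $\mu$ of elements $F_1,\ldots,F_\mu$ such that $I^{(m)} = I^m + (F_1,\ldots,F_\mu)$. *)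

theory Defs
  imports
    "HOL-Algebra.Ideal_Product"
    "HOL-Algebra.Algebraic_Closure_Type"
    "HOL-Library.Poly_Mapping"
begin

section \<open>Polynomial rings\<close>

text \<open>A polynomial maps each monomial (an exponent vector \<open>nat \<Rightarrow>\<^sub>0 nat\<close>) to its coefficient.\<close>

type_synonym 'k mpoly = "(nat \<Rightarrow>\<^sub>0 nat) \<Rightarrow>\<^sub>0 'k"

definition subring_of_type :: "'a::comm_ring_1 set \<Rightarrow> 'a ring" where
  "subring_of_type A = ring_of_type_algebra\<lparr>carrier := A\<rparr>"

text \<open>The polynomial ring \<open>K[x\<^sub>v : v \<in> V]\<close>, inside the ring of polynomials in the variables
  \<open>x\<^sub>0, x\<^sub>1, \<dots>\<close>.\<close>

definition mpoly_ring :: "nat set \<Rightarrow> ('k::field) mpoly ring" where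
  "mpoly_ring V = subring_of_type {p. \<forall>m \<in> Poly_Mapping.keys p. Poly_Mapping.keys m \<subseteq> V}"

definition Var :: "nat \<Rightarrow> ('k::field) mpoly" where
  "Var v = Poly_Mapping.single (Poly_Mapping.single v 1) 1"

lemma subring_of_type_simps [simp]:
  "carrier (subring_of_type A) = A"
  "\<zero>\<^bsub>subring_of_type A\<^esub> = 0"
  "\<one>\<^bsub>subring_of_type A\<^esub> = 1"
  "a \<oplus>\<^bsub>subring_of_type A\<^esub> b = a + b"
  "a \<otimes>\<^bsub>subring_of_type A\<^esub> b = a * b"
  by (simp_all add: subring_of_type_def ring_of_type_algebra_def)

lemma cring_subring_of_type:
  fixes A :: "'a::comm_ring_1 set"
  assumes "0 \<in> A" "1 \<in> A" "\<And>a b. a \<in> A \<Longrightarrow> b \<in> A \<Longrightarrow> a + b \<in> A"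
    "\<And>a b. a \<in> A \<Longrightarrow> b \<in> A \<Longrightarrow> a * b \<in> A" "\<And>a. a \<in> A \<Longrightarrow> - a \<in> A"
  shows "cring (subring_of_type A)"
proof (rule cringI)
  show "abelian_group (subring_of_type A)"
    using assms by (intro abelian_groupI) (auto simp: algebra_simps intro!: bexI[where P = "\<lambda>y. _ + y = 0", OF add.right_inverse])
  show "comm_monoid (subring_of_type A)"
    using assms by (intro comm_monoidI) (auto simp: algebra_simps)
qed (auto simp: algebra_simps)

lemma cring_mpoly_ring: "cring (mpoly_ring V :: ('k::field) mpoly ring)"
  unfolding mpoly_ring_def
proof (rule cring_subring_of_type)
  fix p q :: "'k mpoly"
  assume p: "p \<in> {p. \<forall>m \<in> Poly_Mapping.keys p. Poly_Mapping.keys m \<subseteq> V}"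
    and q: "q \<in> {p. \<forall>m \<in> Poly_Mapping.keys p. Poly_Mapping.keys m \<subseteq> V}"
  show "p + q \<in> {p. \<forall>m \<in> Poly_Mapping.keys p. Poly_Mapping.keys m \<subseteq> V}"
    using p q Poly_Mapping.keys_add[of p q] by blast
  have "Poly_Mapping.keys m \<subseteq> V" if m: "m \<in> Poly_Mapping.keys (p * q)" for m
  proof -
    obtain a b where "a \<in> Poly_Mapping.keys p" "b \<in> Poly_Mapping.keys q" "m = a + b"
      using m keys_mult[of p q] by blast
    then show ?thesis
      using p q Poly_Mapping.keys_add[of a b] by blast
  qed
  then show "p * q \<in> {p. \<forall>m \<in> Poly_Mapping.keys p. Poly_Mapping.keys m \<subseteq> V}"
    by blast
qed auto


section \<open>Symbolic powers and the symbolic defect\<close>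

text \<open>In this section \<open>R\<close> is a subring of an integral domain given as a type, i.e. of the form
  \<open>subring_of_type A\<close>. All its localizations are then subrings of the type of fractions, and \<open>R\<close>
  is identified with its image under \<open>a \<mapsto> a/1\<close>.\<close>

definition localization :: "'a::idom ring \<Rightarrow> 'a set \<Rightarrow> 'a fract ring" where
  "localization R P = subring_of_type {Fract a s | a s. a \<in> carrier R \<and> s \<in> carrier R - P}"

lemma cring_localization:
  fixes A :: "'a::idom set"
  assumes "primeideal P (subring_of_type A)"
  shows "cring (localization (subring_of_type A) P)"
proof -
  interpret primeideal P "subring_of_type A" by fact
  have zero: "0 \<in> A" "0 \<in> P" and one: "1 \<in> A"
    using zero_closed one_closed additive_subgroup.zero_closed[OF is_additive_subgroup] by auto
  have add: "a + b \<in> A" and mult: "a * b \<in> A" if "a \<in> A" "b \<in> A" for a b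
    using that a_closed m_closed by auto
  have minus: "- a \<in> A" if "a \<in> A" for a
  proof -
    have "(\<ominus>\<^bsub>subring_of_type A\<^esub> a) + a = 0" "\<ominus>\<^bsub>subring_of_type A\<^esub> a \<in> A"
      using that l_neg[of a] a_inv_closed[of a] by auto
    then show ?thesis by (metis add_eq_0_iff2)
  qed
  have multP: "a * b \<in> A - P" if "a \<in> A - P" "b \<in> A - P" for a b
    using that I_prime[of a b] mult by auto
  have oneP: "1 \<notin> P"
    using I_notcarr one_imp_carrier by auto
  have nz: "s \<noteq> 0" if "s \<in> A - P" for s
    using that zero by auto
  show ?thesis
    unfolding localization_def subring_of_type_simps
  proof (rule cring_subring_of_type)
    show "0 \<in> {Fract a s | a s. a \<in> A \<and> s \<in> A - P}"
      using zero one oneP Zero_fract_def by blast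
    show "1 \<in> {Fract a s | a s. a \<in> A \<and> s \<in> A - P}"
      using one oneP One_fract_def by blast
  next
    fix x y
    assume "x \<in> {Fract a s | a s. a \<in> A \<and> s \<in> A - P}" "y \<in> {Fract a s | a s. a \<in> A \<and> s \<in> A - P}"
    then obtain a s b u where xy: "x = Fract a s" "y = Fract b u"
      and as: "a \<in> A" "s \<in> A - P" "b \<in> A" "u \<in> A - P" by blast
    have "x + y = Fract (a * u + b * s) (s * u)" "x * y = Fract (a * b) (s * u)"
      using xy as nz by auto
    moreover have "s * u \<in> A - P" using multP as by blast
    moreover have "a * u + b * s \<in> A" "a * b \<in> A" using add mult as by auto
    ultimately show "x + y \<in> {Fract a s | a s. a \<in> A \<and> s \<in> A - P}"
      and "x * y \<in> {Fract a s | a s. a \<in> A \<and> s \<in> A - P}" by blast+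
  next
    fix x
    assume "x \<in> {Fract a s | a s. a \<in> A \<and> s \<in> A - P}"
    then obtain a s where "x = Fract a s" "a \<in> A" "s \<in> A - P" by blast
    moreover have "- Fract a s = Fract (- a) s" by simp
    ultimately show "- x \<in> {Fract a s | a s. a \<in> A \<and> s \<in> A - P}"
      using minus by blast
  qed
qed

text \<open>The associated primes of the \<open>R\<close>-module \<open>R/I\<close>: the prime ideals that are the annihilator of
  the class of some \<open>f\<close>.\<close>

definition associated_primes :: "'a ring \<Rightarrow> 'a set \<Rightarrow> 'a set set" where
  "associated_primes R I =
     {P. primeideal P R \<and> (\<exists>f \<in> carrier R. P = {r \<in> carrier R. r \<otimes>\<^bsub>R\<^esub> f \<in> I})}"

text \<open>\<open>I\<^sup>m S\<^sub>P\<close> is the ideal of \<open>S\<^sub>P\<close> generated by the image of \<open>I\<^sup>m\<close>, where \<open>I\<^sup>m\<close> is the power in the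
  monoid of ideals of \<open>S\<close>.\<close>

definition symbolic_power :: "'a::idom ring \<Rightarrow> 'a set \<Rightarrow> nat \<Rightarrow> 'a set" where
  "symbolic_power R I m =
     {f \<in> carrier R. \<forall>P \<in> associated_primes R I.
        Fract f 1 \<in> Idl\<^bsub>localization R P\<^esub> ((\<lambda>g. Fract g 1) ` (I [^]\<^bsub>ideals_set R\<^esub> m))}"

definition sdefect :: "'a::idom ring \<Rightarrow> 'a set \<Rightarrow> nat \<Rightarrow> nat" where
  "sdefect R I m =
     (LEAST k. \<exists>Fs. length Fs = k \<and> set Fs \<subseteq> carrier R \<and>
        symbolic_power R I m = I [^]\<^bsub>ideals_set R\<^esub> m <+>\<^bsub>R\<^esub> Idl\<^bsub>R\<^esub> (set Fs))"


section \<open>Edge ideals of cycles\<close>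

text \<open>A simple graph is given by its vertex set \<open>V\<close> and its set \<open>E\<close> of two-element edges.\<close>

definition edge_ideal :: "nat set \<Rightarrow> nat set set \<Rightarrow> ('k::field) mpoly set" where
  "edge_ideal V E = Idl\<^bsub>mpoly_ring V\<^esub> {Var i * Var j | i j. {i, j} \<in> E}"

definition cycle_vertices :: "nat \<Rightarrow> nat set" where
  "cycle_vertices N = {1..N}"

text \<open>This is the cycle graph for \<open>N \<ge> 3\<close>.\<close>

definition cycle_edges :: "nat \<Rightarrow> nat set set" where
  "cycle_edges N = insert {N, 1} {{j, j + 1} | j. 1 \<le> j \<and> j \<le> N - 1}"

definition multichoose :: "nat \<Rightarrow> nat \<Rightarrow> nat" where
  "multichoose a b = (a + b - 1) choose b"

end

theory Submission
  imports Defs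
begin

text \<open>
  For the edge ideal \<open>I\<close> of a graph, a monomial \<open>x\<^sup>a\<close> lies in \<open>I\<^sup>(\<^sup>t\<^sup>)\<close> iff every vertex cover has \<open>a\<close>-weight
  at least \<open>t\<close>, since the associated primes are generated by the minimal vertex covers. On the odd
  cycle of length \<open>N = 2n + 1\<close>, such an \<open>a\<close> with \<open>|a| \<ge> 2t\<close> dominates a product of \<open>t\<close> edges, so
  \<open>x\<^sup>a \<in> I\<^sup>t\<close>. Averaging over the covers of size \<open>n + 1\<close> gives \<open>|a| \<ge> 2t - 1\<close> when \<open>t \<le> N\<close>, and
  \<open>|a| = 2t - 1\<close> forces \<open>x\<^sup>a\<close> to be \<open>x\<^sub>1 \<cdots> x\<^sub>N\<close> times a product of \<open>t - n - 1\<close> edges. All these monomials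
  have degree \<open>2t - 1\<close>, below the degrees in \<open>I\<^sup>t\<close>, hence they are minimal generators of \<open>I\<^sup>(\<^sup>t\<^sup>)/I\<^sup>t\<close>; they
  are determined by the multiset of edges because the incidence matrix of an odd cycle is nonsingular.
\<close>


section \<open>Matchings and covers of cycles\<close>

text \<open>On a bipartite graph, weighted Koenig duality would make the least cover weight of
  \<open>a\<close> equal to the largest number of edges that \<open>a\<close> dominates, and
  symbolic and ordinary powers would agree. The odd cycle breaks this: \<open>x_1 ... x_N\<close>
  gives every cover weight at least n + 1 but contains only n disjoint edges. The condition |a| >=
  2t repairs the duality: where two light covers cannot be recombined they are complementary, and
  only the total weight is left to contradict them. The bound t <= N keeps the shortfall from 2t at
  one. Summing over the alternating covers gives |a| >= 2tN/(N + 1), which exceeds 2t - 2 exactly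
  when t <= N. At t = N + 1 the square of \<open>x_1 ... x_N\<close> has all cover weights at least
  t, but degree only 2t - 2.\<close>

definition cyc_succ :: "nat \<Rightarrow> nat \<Rightarrow> nat" where
  "cyc_succ N i = (if i = N then 1 else Suc i)"

text \<open>Edges are indexed by their first end: edge i is \<open>{i, cyc_succ N i}\<close>. Hence
  the two edges at v have the indices v and \<open>cyc_pred N v\<close>, and a multiplicity function
  z puts the load \<open>z v + z (cyc_pred N v)\<close> on v.\<close>

definition cyc_pred :: "nat \<Rightarrow> nat \<Rightarrow> nat" where
  "cyc_pred N i = (if i = 1 then N else i - 1)"

definition path_cover :: "nat \<Rightarrow> nat set \<Rightarrow> bool" where
  "path_cover m W \<longleftrightarrow> W \<subseteq> {1..m} \<and> (\<forall>i\<in>{1..<m}. i \<in> W \<or> Suc i \<in> W)"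

definition cycle_cover :: "nat \<Rightarrow> nat set \<Rightarrow> bool" where
  "cycle_cover N W \<longleftrightarrow> W \<subseteq> {1..N} \<and> (\<forall>i\<in>{1..N}. i \<in> W \<or> cyc_succ N i \<in> W)"

lemma cycle_coverI:
  assumes "path_cover N W" "1 \<in> W \<or> N \<in> W"
  shows "cycle_cover N W"
  using assms unfolding cycle_cover_def path_cover_def cyc_succ_def by auto

text \<open>Here \<open>z v\<close> is the multiplicity of the edge \<open>{v, v + 1}\<close>; \<open>z 0 = 0\<close> and \<open>z m = 0\<close> account for the
  missing edges at the two ends. Induction peels off the last vertex, or the last two.\<close>

lemma path_matching_cover:
  fixes a :: "nat \<Rightarrow> nat"
  shows "\<exists>z W. (\<forall>v\<in>{1..m}. z (v - 1) + z v \<le> a v) \<and> z 0 = 0 \<and> (\<forall>v\<ge>m. z v = 0)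
    \<and> path_cover m W \<and> sum a W \<le> sum z {1..m}"
proof (induction m arbitrary: a rule: less_induct)
  case (less m)
  show ?case
  proof (cases "m \<le> 1")
    case True
    then show ?thesis
      by (intro exI[of _ "\<lambda>_. 0"] exI[of _ "{}"]) (auto simp: path_cover_def)
  next
    case False
    then obtain p where m: "m = Suc (Suc p)"
      by (metis One_nat_def Suc_le_mono le0 not0_implies_Suc nle_le)
    show ?thesis
    proof (cases "a m \<le> a (Suc p)")
      case True
      \<comment> \<open>The last edge absorbs all of \<open>a m\<close>. This removes the vertex m
        and leaves \<open>Suc p\<close> with the remaining capacity.\<close>
      obtain z W where z: "\<forall>v\<in>{1..Suc p}. z (v - 1) + z v \<le> (a(Suc p := a (Suc p) - a m)) v"
        "z 0 = 0" "\<forall>v\<ge>Suc p. z v = 0"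
        and W: "path_cover (Suc p) W" "sum (a(Suc p := a (Suc p) - a m)) W \<le> sum z {1..Suc p}"
        using less.IH[of "Suc p" "a(Suc p := a (Suc p) - a m)"] m by blast
      let ?z = "z(Suc p := a m)"
      \<comment> \<open>The weight of the cover must grow by exactly \<open>a m\<close>. If
        \<open>Suc p\<close> is in W, restoring its full weight does this; otherwise the last edge
        is uncovered and m is added.\<close>
      let ?W = "if Suc p \<in> W then W else insert m W"
      have fin: "finite W" using W(1) by (auto simp: path_cover_def intro: finite_subset)
      have mW: "m \<notin> W" using W(1) m by (auto simp: path_cover_def)
      have "sum a ?W = sum (a(Suc p := a (Suc p) - a m)) W + a m"
      proof (cases "Suc p \<in> W")
        case True
        have "sum a (W - {Suc p}) = sum (a(Suc p := a (Suc p) - a m)) (W - {Suc p})"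
          by (intro sum.cong) auto
        then show ?thesis
          using True fin \<open>a m \<le> a (Suc p)\<close> sum.remove[OF fin True, of a]
            sum.remove[OF fin True, of "a(Suc p := a (Suc p) - a m)"] by simp
      next
        case False
        then show ?thesis using fin mW by (auto simp: algebra_simps intro!: sum.cong)
      qed
      moreover have "sum ?z {1..m} = sum z {1..Suc p} + a m"
      proof -
        have "sum ?z {1..m} = sum ?z {1..p} + a m"
          using z(3) m by simp
        also have "sum ?z {1..p} = sum z {1..p}" by (intro sum.cong) auto
        finally show ?thesis using z(3) by simp
      qed
      ultimately have "sum a ?W \<le> sum ?z {1..m}" using W(2) by linarith
      moreover have "path_cover m ?W"
        using W(1) m by (auto simp: path_cover_def less_Suc_eq)
      moreover have "\<forall>v\<in>{1..m}. ?z (v - 1) + ?z v \<le> a v"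
      proof
        fix v assume v: "v \<in> {1..m}"
        consider "v \<in> {1..p}" | "v = Suc p" | "v = m" using v m by fastforce
        then show "?z (v - 1) + ?z v \<le> a v"
        proof cases
          case 1
          then have "v - 1 \<noteq> Suc p" by auto
          then show ?thesis using z(1)[rule_format, of v] 1 by simp
        next
          case 2 then show ?thesis using z(1)[rule_format, of "Suc p"] True z(3) by simp
        next
          case 3 then show ?thesis using z(3) m by simp
        qed
      qed
      moreover have "?z 0 = 0" "\<forall>v\<ge>m. ?z v = 0" using z m by auto
      ultimately show ?thesis by (intro exI[of _ ?z] exI[of _ ?W] conjI) assumption+
    next
      case False
      \<comment> \<open>Now the last edge exhausts \<open>Suc p\<close>, so both end vertices drop
        out. Adding \<open>Suc p\<close> to the cover takes care of the last two edges at
        once.\<close>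
      obtain z W where z: "\<forall>v\<in>{1..p}. z (v - 1) + z v \<le> a v"
        "z 0 = 0" "\<forall>v\<ge>p. z v = 0"
        and W: "path_cover p W" "sum a W \<le> sum z {1..p}"
        using less.IH[of p a] m by auto
      let ?z = "z(Suc p := a (Suc p))"
      let ?W = "insert (Suc p) W"
      have "finite W" "Suc p \<notin> W"
        using W(1) by (auto simp: path_cover_def intro: finite_subset)
      then have "sum a ?W = sum a W + a (Suc p)" by simp
      moreover have "sum ?z {1..m} = sum z {1..p} + a (Suc p)"
      proof -
        have "sum ?z {1..m} = sum ?z {1..p} + a (Suc p)"
          using z(3) m by simp
        also have "sum ?z {1..p} = sum z {1..p}" by (intro sum.cong) auto
        finally show ?thesis .
      qed
      ultimately have "sum a ?W \<le> sum ?z {1..m}" using W(2) by linarith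
      moreover have "path_cover m ?W"
        using W(1) m by (auto simp: path_cover_def less_Suc_eq)
      moreover have "\<forall>v\<in>{1..m}. ?z (v - 1) + ?z v \<le> a v"
      proof
        fix v assume v: "v \<in> {1..m}"
        consider "v \<in> {1..p}" | "v = Suc p" | "v = m" using v m by fastforce
        then show "?z (v - 1) + ?z v \<le> a v"
        proof cases
          case 1
          then have "v - 1 \<noteq> Suc p" by auto
          then show ?thesis using z(1)[rule_format, of v] 1 by simp
        next
          case 2 then show ?thesis using z(3) by simp
        next
          case 3 then show ?thesis using z(3) m False by simp
        qed
      qed
      moreover have "?z 0 = 0" "\<forall>v\<ge>m. ?z v = 0" using z m by auto
      ultimately show ?thesis by (intro exI[of _ ?z] exI[of _ ?W] conjI) assumption+
    qed
  qed
qed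

section \<open>Recombination of covers and the duality on the cycle\<close>

lemma sum_swap_at:
  fixes a :: "nat \<Rightarrow> nat"
  assumes "finite W" "finite W'"
  shows "sum a (W \<inter> {..v} \<union> W' \<inter> {v<..}) + sum a (W' \<inter> {..v} \<union> W \<inter> {v<..}) = sum a W + sum a W'"
proof -
  have split: "sum a U = sum a (U \<inter> {..v}) + sum a (U \<inter> {v<..})" if "finite U" for U
  proof -
    have "sum a (U \<inter> {..v} \<union> U \<inter> {v<..}) = sum a (U \<inter> {..v}) + sum a (U \<inter> {v<..})"
      using that by (intro sum.union_disjoint) auto
    moreover have "U \<inter> {..v} \<union> U \<inter> {v<..} = U" by auto
    ultimately show ?thesis by simp
  qed
  have "sum a (U \<inter> {..v} \<union> U' \<inter> {v<..}) = sum a (U \<inter> {..v}) + sum a (U' \<inter> {v<..})"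
    if "finite U" "finite U'" for U U'
    using that by (intro sum.union_disjoint) auto
  then show ?thesis using split[OF assms(1)] split[OF assms(2)] assms by simp
qed

text \<open>Only the edge from v to v + 1 joins the two pieces. If v is in neither cover, then W'
  contains v + 1.\<close>

lemma path_cover_swap:
  assumes "path_cover N W" "path_cover N W'" "v \<in> W \<longleftrightarrow> v \<in> W'"
  shows "path_cover N (W \<inter> {..v} \<union> W' \<inter> {v<..})"
  unfolding path_cover_def
proof (intro conjI ballI)
  show "W \<inter> {..v} \<union> W' \<inter> {v<..} \<subseteq> {1..N}" using assms by (auto simp: path_cover_def)
  fix i assume i: "i \<in> {1..<N}"
  consider "i < v" | "i = v" | "i > v" by linarith
  then show "i \<in> W \<inter> {..v} \<union> W' \<inter> {v<..} \<or> Suc i \<in> W \<inter> {..v} \<union> W' \<inter> {v<..}"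
    using assms i by cases (auto simp: path_cover_def)
qed

text \<open>Give the edge \<open>{N, 1}\<close> the multiplicity \<open>k\<close> and apply the path duality to the rest. If no \<open>k\<close>
  yields \<open>t\<close> edges, the optimal path covers contain neither of \<open>1\<close> and \<open>N\<close> for some \<open>k\<close>, and both for
  \<open>k + 1\<close>. Two such covers either agree at a vertex, where they can be recombined into two cycle
  covers, or are complementary; both contradict the weight bounds.\<close>

lemma cycle_matching:
  fixes a :: "nat \<Rightarrow> nat"
  assumes N: "N \<ge> 2"
    and cov: "\<And>W. cycle_cover N W \<Longrightarrow> t \<le> sum a W"
    and tot: "2 * t \<le> sum a {1..N}"
  shows "\<exists>z. (\<forall>v\<in>{1..N}. z v + z (cyc_pred N v) \<le> a v) \<and> t \<le> sum z {1..N}"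
proof (rule ccontr)
  assume no: "\<not> ?thesis"
  let ?m = "min (a 1) (a N)"
  \<comment> \<open>After k copies of the edge \<open>{N, 1}\<close> are spent, failure means a path
    cover of reduced weight below t - k. Its true weight is then below t - k if it avoids both ends,
    below t + k if it contains both, and below t if it contains one; the last kind is a cycle cover
    and contradicts \<open>cov\<close>.\<close>
  define P where "P k \<longleftrightarrow> (\<exists>W. path_cover N W \<and> 1 \<notin> W \<and> N \<notin> W \<and> sum a W + k < t)" for k
  define Q where "Q k \<longleftrightarrow> (\<exists>W. path_cover N W \<and> 1 \<in> W \<and> N \<in> W \<and> sum a W < t + k)" for k
  have PQ: "P k \<or> Q k" if k: "k \<le> ?m" for k
  proof -
    let ?a = "a(1 := a 1 - k, N := a N - k)"
    obtain z W where z: "\<forall>v\<in>{1..N}. z (v - 1) + z v \<le> ?a v" "z 0 = 0" "\<forall>v\<ge>N. z v = 0"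
      and W: "path_cover N W" "sum ?a W \<le> sum z {1..N}"
      using path_matching_cover[of N ?a] by blast
    let ?z = "z(N := k)"
    have "?z v + ?z (cyc_pred N v) \<le> a v" if v: "v \<in> {1..N}" for v
    proof -
      consider "v = 1" | "v = N" | "v \<noteq> 1" "v \<noteq> N" by blast
      then show ?thesis
        using z(1)[rule_format, OF v] k N z(2,3) v by cases (auto simp: cyc_pred_def)
    qed
    then have "sum ?z {1..N} < t" using no by (meson not_le)
    moreover have "sum ?z {1..N} = sum z {1..N} + k"
    proof -
      have "sum ?z {1..N} = k + sum ?z ({1..N} - {N})"
        using N sum.remove[of "{1..N}" N ?z] by simp
      also have "sum ?z ({1..N} - {N}) = sum z ({1..N} - {N})" by (intro sum.cong) auto
      also have "\<dots> = sum z {1..N}" using N z(3) sum.remove[of "{1..N}" N z] by simp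
      finally show ?thesis by simp
    qed
    ultimately have lt: "sum ?a W + k < t" using W(2) by linarith
    have fin: "finite W" using W(1) by (auto simp: path_cover_def intro: finite_subset)
    have sa: "sum a W = sum ?a W + (if 1 \<in> W then k else 0) + (if N \<in> W then k else 0)"
    proof -
      have "sum a W = (\<Sum>v\<in>W. ?a v + (if v = 1 then k else 0) + (if v = N then k else 0))"
        using k N by (intro sum.cong) auto
      then show ?thesis using fin by (simp add: sum.distrib)
    qed
    show ?thesis
    proof (cases "1 \<in> W \<longleftrightarrow> N \<in> W")
      case True
      then show ?thesis using sa lt W(1) unfolding P_def Q_def by (cases "1 \<in> W") (auto intro!: exI[of _ W])
    next
      case False
      then have "cycle_cover N W" using cycle_coverI W(1) by blast
      then show ?thesis using cov[of W] sa lt False by (auto split: if_splits)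
    qed
  qed
  have nQ0: "\<not> Q 0"
    unfolding Q_def using cov cycle_coverI by (metis add_0_right not_le)
  \<comment> \<open>At this k one end has weight exactly k. Adding that end to the cover yields a
    cycle cover that still weighs less than t.\<close>
  have nPm: "\<not> P ?m"
  proof
    assume "P ?m"
    then obtain W where W: "path_cover N W" "1 \<notin> W" "N \<notin> W" "sum a W + ?m < t"
      unfolding P_def by blast
    define u where "u = (if a 1 \<le> a N then 1 else N)"
    have u: "a u = ?m" "u \<notin> W" "u \<in> {1,N}" using W by (auto simp: u_def)
    have "path_cover N (insert u W)" using W(1) u N by (auto simp: path_cover_def)
    then have "t \<le> sum a (insert u W)" using u cov cycle_coverI by blast
    moreover have "finite W" using W(1) by (auto simp: path_cover_def intro: finite_subset)
    ultimately show False using u W by simp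
  qed
  \<comment> \<open>A discrete intermediate value argument: P holds at 0 and fails at
    \<open>?m\<close>, so somewhere it gives way to Q.\<close>
  have "\<exists>k<?m. P k \<and> Q (Suc k)"
  proof (rule ccontr)
    assume c: "\<not> (\<exists>k<?m. P k \<and> Q (Suc k))"
    have "k \<le> ?m \<Longrightarrow> P k" for k
    proof (induction k)
      case 0 then show ?case using PQ nQ0 by blast
    next
      case (Suc k) then show ?case using PQ[of "Suc k"] c by (metis Suc_le_lessD less_imp_le)
    qed
    then show False using nPm by blast
  qed
  then obtain k W W' where W: "path_cover N W" "1 \<notin> W" "N \<notin> W" "sum a W + k < t"
    and W': "path_cover N W'" "1 \<in> W'" "N \<in> W'" "sum a W' < t + Suc k"
    unfolding P_def Q_def by blast
  have fin: "finite W" "finite W'" and sub: "W \<subseteq> {1..N}" "W' \<subseteq> {1..N}"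
    using W(1) W'(1) by (auto simp: path_cover_def intro: finite_subset)
  \<comment> \<open>Consecutive values matter here: the weights are at most t - k - 1 and t + k,
    which add up to 2t - 1.\<close>
  have lt: "sum a W + sum a W' < 2 * t" using W(4) W'(4) by linarith
  show False
  proof (cases "\<exists>v. v \<in> {1..N} \<and> (v \<in> W \<longleftrightarrow> v \<in> W')")
    case True
    then obtain v where v: "v \<in> {1..N}" "v \<in> W \<longleftrightarrow> v \<in> W'" by blast
    then have v1N: "1 < v" "v < N" using W W' by (metis atLeastAtMost_iff le_neq_implies_less)+
    \<comment> \<open>As v lies strictly between the ends, the first mixture inherits N from W' and
      the second inherits 1. So both also cover the edge \<open>{N, 1}\<close>.\<close>
    have 1: "cycle_cover N (W \<inter> {..v} \<union> W' \<inter> {v<..})"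
      using path_cover_swap[OF W(1) W'(1) v(2)] W' v1N by (intro cycle_coverI) auto
    have 2: "cycle_cover N (W' \<inter> {..v} \<union> W \<inter> {v<..})"
      using path_cover_swap[OF W'(1) W(1) v(2)[symmetric]] W' v1N by (intro cycle_coverI) auto
    show False using cov[OF 1] cov[OF 2] sum_swap_at[OF fin, of a v] lt by linarith
  next
    case False
    then have "W \<union> W' = {1..N}" "W \<inter> W' = {}" using sub by auto
    then have "sum a W + sum a W' = sum a {1..N}" using sum.union_disjoint[OF fin, of a] by simp
    then show False using lt tot by linarith
  qed
qed

section \<open>Double counting and alternating covers\<close>

lemma sum_cyc_succ: "N \<ge> 1 \<Longrightarrow> (\<Sum>i\<in>{1..N}. f (cyc_succ N i)) = sum f {1..N}"
  by (rule sum.reindex_bij_witness[of _ "cyc_pred N" "cyc_succ N"])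
     (auto simp: cyc_succ_def cyc_pred_def)

lemma sum_cyc_pred: "N \<ge> 1 \<Longrightarrow> (\<Sum>i\<in>{1..N}. f (cyc_pred N i)) = sum f {1..N}"
  by (rule sum.reindex_bij_witness[of _ "cyc_succ N" "cyc_pred N"])
     (auto simp: cyc_succ_def cyc_pred_def)

lemma cyc_pred_succ: "i \<in> {1..N} \<Longrightarrow> cyc_pred N (cyc_succ N i) = i"
  by (auto simp: cyc_succ_def cyc_pred_def)

text \<open>Double counting: the right side counts each edge once for every end in W, hence at least
  once. The constant function z = 1 bounds the size of a cover, and general z bounds the cover
  weight of a product of edges.\<close>

lemma cycle_cover_load:
  fixes z :: "nat \<Rightarrow> nat"
  assumes W: "cycle_cover N W"
  shows "sum z {1..N} \<le> (\<Sum>v\<in>W. z v + z (cyc_pred N v))"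
proof (cases "N = 0")
  case False
  let ?c = "\<lambda>v. if v \<in> W then 1 else 0 :: nat"
  have sub: "W \<subseteq> {1..N}" using W by (auto simp: cycle_cover_def)
  have "(\<Sum>v\<in>W. z v + z (cyc_pred N v)) = (\<Sum>v\<in>{1..N}. ?c v * (z v + z (cyc_pred N v)))"
    using sub by (intro sum.mono_neutral_cong_left) auto
  also have "\<dots> = (\<Sum>v\<in>{1..N}. ?c v * z v) + (\<Sum>v\<in>{1..N}. ?c v * z (cyc_pred N v))"
    by (simp add: sum.distrib algebra_simps)
  also have "(\<Sum>v\<in>{1..N}. ?c v * z (cyc_pred N v))
      = (\<Sum>i\<in>{1..N}. ?c (cyc_succ N i) * z (cyc_pred N (cyc_succ N i)))"
    using False sum_cyc_succ[of N "\<lambda>v. ?c v * z (cyc_pred N v)"] by simp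
  also have "\<dots> = (\<Sum>i\<in>{1..N}. ?c (cyc_succ N i) * z i)"
    by (intro sum.cong) (simp_all add: cyc_pred_succ)
  also have "(\<Sum>v\<in>{1..N}. ?c v * z v) + \<dots> = (\<Sum>i\<in>{1..N}. (?c i + ?c (cyc_succ N i)) * z i)"
    by (simp add: sum.distrib algebra_simps)
  finally have eq: "(\<Sum>v\<in>W. z v + z (cyc_pred N v)) = (\<Sum>i\<in>{1..N}. (?c i + ?c (cyc_succ N i)) * z i)" .
  have "z i \<le> (?c i + ?c (cyc_succ N i)) * z i" if "i \<in> {1..N}" for i
    using W that by (auto simp: cycle_cover_def)
  then show ?thesis unfolding eq by (intro sum_mono)
qed simp

text \<open>The cover of an odd cycle in which only the edge \<open>{i, cyc_succ N i}\<close> has both ends.\<close>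

definition alt_cover :: "nat \<Rightarrow> nat \<Rightarrow> nat set" where
  "alt_cover N i = {j\<in>{1..N}. j \<le> i \<longleftrightarrow> even (i + j)}"

lemma alt_cover: "odd N \<Longrightarrow> i \<in> {1..N} \<Longrightarrow> cycle_cover N (alt_cover N i)"
  unfolding cycle_cover_def alt_cover_def cyc_succ_def
  by (auto simp: less_Suc_eq not_le)

text \<open>Moving the doubled edge one step along the cycle complements the cover, except that the
  vertex shared by the two doubled edges stays in both.\<close>

lemma sum_alt_cover:
  fixes a :: "nat \<Rightarrow> nat"
  assumes "odd N" "i \<in> {1..N}"
  shows "sum a (alt_cover N i) + sum a (alt_cover N (cyc_succ N i)) = sum a {1..N} + a (cyc_succ N i)"
proof -
  have s: "cyc_succ N i \<in> {1..N}" using assms by (auto simp: cyc_succ_def)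
  have sub: "alt_cover N k \<subseteq> {1..N}" for k by (auto simp: alt_cover_def)
  have mem: "j \<in> alt_cover N (cyc_succ N i) \<longleftrightarrow> j \<notin> alt_cover N i \<or> j = cyc_succ N i"
    if j: "j \<in> {1..N}" for j
  proof (cases "i = N")
    case True
    then show ?thesis using j assms by (cases "j = 1") (auto simp: alt_cover_def cyc_succ_def)
  next
    case False
    consider "j \<le> i" | "j = Suc i" | "j > Suc i" by linarith
    then show ?thesis using j False by cases (auto simp: alt_cover_def cyc_succ_def)
  qed
  have "sum a (alt_cover N i) + sum a (alt_cover N (cyc_succ N i))
     = sum a (alt_cover N i \<union> alt_cover N (cyc_succ N i)) + sum a (alt_cover N i \<inter> alt_cover N (cyc_succ N i))"
    by (intro sum.union_inter[symmetric]) (auto simp: alt_cover_def)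
  moreover have "alt_cover N i \<union> alt_cover N (cyc_succ N i) = {1..N}"
    using mem sub by blast
  moreover have "cyc_succ N i \<in> alt_cover N i"
    using assms by (auto simp: alt_cover_def cyc_succ_def)
  then have "alt_cover N i \<inter> alt_cover N (cyc_succ N i) = {cyc_succ N i}"
    using mem s sub by blast
  ultimately show ?thesis by simp
qed

text \<open>Summing \<open>sum_alt_cover\<close> over all i gives N * 2t <= (N + 1) |a|. Were |a| <=
  2t - 2, this would force t >= N + 1.\<close>

lemma odd_cycle_weight:
  fixes a :: "nat \<Rightarrow> nat"
  assumes N: "N = 2 * n + 1" and cov: "\<And>W. cycle_cover N W \<Longrightarrow> t \<le> sum a W" and t: "t \<le> N"
  shows "2 * t \<le> sum a {1..N} + 1"
proof -
  let ?s = "sum a {1..N}"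
  have "N * (2 * t) = (\<Sum>i\<in>{1..N}. 2 * t)" by simp
  also have "\<dots> \<le> (\<Sum>i\<in>{1..N}. ?s + a (cyc_succ N i))"
  proof (intro sum_mono)
    fix i assume i: "i \<in> {1..N}"
    have "cyc_succ N i \<in> {1..N}" using i by (auto simp: cyc_succ_def)
    then have "t \<le> sum a (alt_cover N i)" "t \<le> sum a (alt_cover N (cyc_succ N i))"
      using i N by (auto intro!: cov alt_cover)
    then show "2 * t \<le> ?s + a (cyc_succ N i)" using sum_alt_cover[of N i a] i N by simp
  qed
  also have "\<dots> = N * ?s + ?s"
    using sum_cyc_succ[of N a] N by (simp only: sum.distrib) simp
  finally have le: "N * (2 * t) \<le> (2 * n + 2) * ?s" using N by simp
  show ?thesis
  proof (rule ccontr)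
    assume "\<not> ?thesis"
    then have "?s + 2 \<le> 2 * t" by simp
    then have "(2 * n + 2) * (?s + 2) \<le> (2 * n + 2) * (2 * t)" by (intro mult_le_mono) auto
    with le have "4 * n + 4 \<le> 2 * t" using N by (simp add: algebra_simps)
    then show False using t N by simp
  qed
qed

text \<open>Solving the linear system for \<open>z\<close> gives the excess over \<open>t\<close> of the weights of the alternating
  covers.\<close>

lemma odd_cycle_tight:
  fixes a :: "nat \<Rightarrow> nat"
  assumes N: "N = 2 * n + 1" and cov: "\<And>W. cycle_cover N W \<Longrightarrow> t \<le> sum a W"
    and tot: "sum a {1..N} + 1 = 2 * t"
  shows "\<exists>z. (\<forall>v\<in>{1..N}. a v = 1 + z v + z (cyc_pred N v))
    \<and> sum z {1..N} + n + 1 = t"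
proof -
  \<comment> \<open>No truncation occurs, since alternating covers weigh at least t. The excesses of
    two consecutive covers sharing v add up to |a| + a v - 2t = a v - 1.\<close>
  define z where "z i = sum a (alt_cover N i) - t" for i
  have z: "a v = 1 + z v + z (cyc_pred N v)" if v: "v \<in> {1..N}" for v
  proof -
    let ?p = "cyc_pred N v"
    have p: "?p \<in> {1..N}" "cyc_succ N ?p = v" using v by (auto simp: cyc_pred_def cyc_succ_def)
    then have "t \<le> sum a (alt_cover N v)" "t \<le> sum a (alt_cover N ?p)"
      using v N by (auto intro!: cov alt_cover)
    then show ?thesis using sum_alt_cover[of N ?p a] p tot N unfolding z_def by simp
  qed
  have "sum a {1..N} = (\<Sum>v\<in>{1..N}. 1 + z v + z (cyc_pred N v))"
    by (intro sum.cong refl z)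
  also have "\<dots> = N + sum z {1..N} + sum z {1..N}"
    unfolding sum.distrib using sum_cyc_pred[of N z] N by simp
  finally have "sum z {1..N} + n + 1 = t" using tot N by linarith
  then show ?thesis using z by blast
qed

text \<open>The incidence matrix of an odd cycle is nonsingular.\<close>

lemma odd_cycle_load_inj:
  fixes z z' :: "nat \<Rightarrow> nat"
  assumes N: "odd N"
    and "\<And>v. v \<in> {1..N} \<Longrightarrow> z v + z (cyc_pred N v) = z' v + z' (cyc_pred N v)"
    and i: "i \<in> {1..N}"
  shows "z i = z' i"
proof -
  define d where "d i = int (z i) - int (z' i)" for i
  have d: "d v = - d (cyc_pred N v)" if "v \<in> {1..N}" for v
    using assms(2)[OF that] by (simp add: d_def)
  have alt: "Suc k \<le> N \<Longrightarrow> d (Suc k) = (- 1) ^ k * d 1" for k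
  proof (induction k)
    case (Suc k) then show ?case using d[of "Suc (Suc k)"] by (simp add: cyc_pred_def)
  qed simp
  \<comment> \<open>N - 1 sign changes cancel because N is odd; the closing edge contributes one
    more, so \<open>d 1\<close> equals its own negative.\<close>
  have "d N = d 1" using alt[of "N - 1"] N i by simp
  moreover have "d 1 = - d N" using d[of 1] i by (simp add: cyc_pred_def)
  ultimately have "d 1 = 0" by simp
  then show ?thesis using alt[of "i - 1"] i by (auto simp: d_def)
qed


section \<open>Monomial ideals and localization\<close>

lemma mpoly_ring_simps [simp]:
  "carrier (mpoly_ring V) = {p. \<forall>m\<in>Poly_Mapping.keys p. Poly_Mapping.keys m \<subseteq> V}"
  "\<zero>\<^bsub>mpoly_ring V\<^esub> = 0" "\<one>\<^bsub>mpoly_ring V\<^esub> = 1"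
  "p \<oplus>\<^bsub>mpoly_ring V\<^esub> q = p + q" "p \<otimes>\<^bsub>mpoly_ring V\<^esub> q = p * q"
  by (simp_all add: mpoly_ring_def)

lemma ring_mpoly_ring: "ring (mpoly_ring V)"
  using cring_mpoly_ring cring.axioms(1) by blast

text \<open>The restriction of p to the exponents in A, written as a sum of terms so that ideal
  membership can be proved term by term.\<close>

definition part :: "('a \<Rightarrow>\<^sub>0 'k::comm_monoid_add) \<Rightarrow> 'a set \<Rightarrow> 'a \<Rightarrow>\<^sub>0 'k" where
  "part p A = (\<Sum>m\<in>Poly_Mapping.keys p \<inter> A. Poly_Mapping.single m (Poly_Mapping.lookup p m))"

lemma lookup_part:
  "Poly_Mapping.lookup (part p A) m = (if m \<in> A then Poly_Mapping.lookup p m else 0)"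
proof -
  have "Poly_Mapping.lookup (part p A) m
      = (\<Sum>x\<in>Poly_Mapping.keys p \<inter> A. if x = m then Poly_Mapping.lookup p x else 0)"
    by (simp add: part_def lookup_sum lookup_single when_def)
  then show ?thesis by (auto simp: in_keys_iff)
qed

lemma keys_part: "Poly_Mapping.keys (part p A) = Poly_Mapping.keys p \<inter> A"
  by (auto simp: in_keys_iff lookup_part split: if_splits)

lemma part_add: "part (p + q) A = part p A + part q A"
  by (rule poly_mapping_eqI) (simp add: lookup_part lookup_add)

lemma part_add_Compl: "part p A + part p (- A) = p"
  by (rule poly_mapping_eqI) (simp add: lookup_part lookup_add)

text \<open>Addition of exponents is cancellative, so only the term of p at m can contribute to c +
  m.\<close>

lemma lookup_single_mult:
  fixes p :: "'k::field mpoly"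
  shows "Poly_Mapping.lookup (Poly_Mapping.single c 1 * p) (c + m) = Poly_Mapping.lookup p m"
proof -
  have "part p {m} = Poly_Mapping.single m (Poly_Mapping.lookup p m)"
    by (rule poly_mapping_eqI) (auto simp: lookup_part lookup_single when_def)
  then have 1: "Poly_Mapping.lookup (Poly_Mapping.single c 1 * part p {m}) (c + m) = Poly_Mapping.lookup p m"
    by (simp add: mult_single)
  have "c + m \<notin> Poly_Mapping.keys (Poly_Mapping.single c 1 * part p (- {m}))"
    using keys_mult[of "Poly_Mapping.single c 1" "part p (- {m})"] by (auto simp: keys_part)
  then have 2: "Poly_Mapping.lookup (Poly_Mapping.single c 1 * part p (- {m})) (c + m) = 0"
    by (simp add: in_keys_iff)
  have "Poly_Mapping.single c 1 * p
      = Poly_Mapping.single c 1 * part p {m} + Poly_Mapping.single c 1 * part p (- {m})"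
    by (simp add: part_add_Compl flip: distrib_left)
  then show ?thesis using 1 2 by (simp add: lookup_add)
qed

lemma keys_single_mult:
  fixes p :: "'k::field mpoly"
  shows "Poly_Mapping.keys (Poly_Mapping.single c 1 * p) = (+) c ` Poly_Mapping.keys p"
proof
  show "Poly_Mapping.keys (Poly_Mapping.single c 1 * p) \<subseteq> (+) c ` Poly_Mapping.keys p"
    using keys_mult[of "Poly_Mapping.single c 1" p] by auto
  show "(+) c ` Poly_Mapping.keys p \<subseteq> Poly_Mapping.keys (Poly_Mapping.single c 1 * p)"
    by (auto simp: in_keys_iff lookup_single_mult)
qed

lemma keys_plus_nat:
  fixes m m' :: "'a \<Rightarrow>\<^sub>0 nat"
  shows "Poly_Mapping.keys (m + m') = Poly_Mapping.keys m \<union> Poly_Mapping.keys m'"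
  by (auto simp: in_keys_iff lookup_add)

text \<open>The parts of lowest weight have a nonzero product, as the ring is a domain.\<close>

lemma weight_ge_of_mult:
  fixes s p :: "'k::field mpoly" and wt :: "(nat \<Rightarrow>\<^sub>0 nat) \<Rightarrow> nat"
  assumes add: "\<And>m m'. wt (m + m') = wt m + wt m'"
    and s: "m\<^sub>0 \<in> Poly_Mapping.keys s" "wt m\<^sub>0 = 0"
    and sp: "\<And>m. m \<in> Poly_Mapping.keys (s * p) \<Longrightarrow> t \<le> wt m"
    and m: "m \<in> Poly_Mapping.keys p"
  shows "t \<le> wt m"
proof (rule ccontr)
  assume lt: "\<not> t \<le> wt m"
  define d where "d = Min (wt ` Poly_Mapping.keys p)"
  have d: "d \<in> wt ` Poly_Mapping.keys p" "\<And>k. k \<in> Poly_Mapping.keys p \<Longrightarrow> d \<le> wt k"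
    using m by (auto simp: d_def intro!: Min_in)
  have "d < t" using d(2)[OF m] lt by simp
  let ?A = "{k. wt k = 0}" and ?B = "{k. wt k = d}"
  have "part s ?A \<noteq> 0"
    using s by (metis (mono_tags) IntI empty_iff keys_part keys_zero mem_Collect_eq)
  moreover obtain k\<^sub>0 where "k\<^sub>0 \<in> Poly_Mapping.keys p" "wt k\<^sub>0 = d" using d(1) by blast
  then have "part p ?B \<noteq> 0"
    by (metis (mono_tags) IntI empty_iff keys_part keys_zero mem_Collect_eq)
  ultimately have "part s ?A * part p ?B \<noteq> 0" by simp
  then obtain k where k: "k \<in> Poly_Mapping.keys (part s ?A * part p ?B)" by fastforce
  then have "wt k = d"
    using keys_mult[of "part s ?A" "part p ?B"] by (auto simp: keys_part add)
  \<comment> \<open>The other contributions to s p contain no monomial of weight d, so nothing can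
    cancel the coefficient at k.\<close>
  have "k \<notin> Poly_Mapping.keys (part s ?A * part p (- ?B))"
  proof
    assume "k \<in> Poly_Mapping.keys (part s ?A * part p (- ?B))"
    then obtain a b where "k = a + b" "wt a = 0" "wt b \<noteq> d"
      using keys_mult[of "part s ?A" "part p (- ?B)"] by (fastforce simp: keys_part)
    then show False using \<open>wt k = d\<close> add by simp
  qed
  moreover have "k \<notin> Poly_Mapping.keys (part s (- ?A) * p)"
  proof
    assume "k \<in> Poly_Mapping.keys (part s (- ?A) * p)"
    then obtain a b where "k = a + b" "wt a \<noteq> 0" "b \<in> Poly_Mapping.keys p"
      using keys_mult[of "part s (- ?A)" p] by (fastforce simp: keys_part)
    then show False using \<open>wt k = d\<close> add d(2)[of b] by simp
  qed
  moreover have "s * p = part s ?A * part p ?B + (part s ?A * part p (- ?B) + part s (- ?A) * p)"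
  proof -
    have "s * p = part s ?A * p + part s (- ?A) * p"
      by (simp add: part_add_Compl flip: distrib_right)
    also have "part s ?A * p = part s ?A * part p ?B + part s ?A * part p (- ?B)"
      by (simp add: part_add_Compl flip: distrib_left)
    finally show ?thesis by (simp add: add.assoc)
  qed
  ultimately have "Poly_Mapping.lookup (s * p) k = Poly_Mapping.lookup (part s ?A * part p ?B) k"
    by (simp add: lookup_add in_keys_iff)
  then have "k \<in> Poly_Mapping.keys (s * p)" using k by (simp add: in_keys_iff)
  then show False using sp \<open>wt k = d\<close> \<open>d < t\<close> by fastforce
qed

section \<open>Ideals, membership by monomials, and localization\<close>

lemma subring_of_type_uminus:
  assumes "ring (subring_of_type A)" "a \<in> A"
  shows "\<ominus>\<^bsub>subring_of_type A\<^esub> a = - a"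
proof -
  interpret ring "subring_of_type A" by fact
  have "(\<ominus>\<^bsub>subring_of_type A\<^esub> a) + a = 0" using assms l_neg[of a] by simp
  then show ?thesis by (simp add: eq_neg_iff_add_eq_0)
qed

lemma idealI_subring_of_type:
  assumes R: "cring (subring_of_type A)" and "Q \<subseteq> A" "0 \<in> Q"
    and add: "\<And>a b. a \<in> Q \<Longrightarrow> b \<in> Q \<Longrightarrow> a + b \<in> Q"
    and mult: "\<And>r a. r \<in> A \<Longrightarrow> a \<in> Q \<Longrightarrow> r * a \<in> Q"
  shows "ideal Q (subring_of_type A)"
proof (rule idealI)
  interpret cring "subring_of_type A" by fact
  show "ring (subring_of_type A)" by unfold_locales
  have "- 1 \<in> A"
    using a_inv_closed[of 1] subring_of_type_uminus[of A 1] one_closed ring_axioms by auto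
  then have minus: "- a \<in> Q" if "a \<in> Q" for a using mult[of "- 1" a] that by simp
  show "subgroup Q (add_monoid (subring_of_type A))"
  proof (rule subgroup.intro)
    fix x assume "x \<in> Q"
    then show "inv\<^bsub>add_monoid (subring_of_type A)\<^esub> x \<in> Q"
      using minus[of x] subring_of_type_uminus[of A x] assms(2) ring_axioms
      by (auto simp: a_inv_def)
  qed (use assms in auto)
next
  fix a x assume "a \<in> Q" "x \<in> carrier (subring_of_type A)"
  then show "x \<otimes>\<^bsub>subring_of_type A\<^esub> a \<in> Q" "a \<otimes>\<^bsub>subring_of_type A\<^esub> x \<in> Q"
    using mult[of x a] by (simp_all add: mult.commute[of a x])
qed

lemma monomial_ideal:
  assumes "\<And>m. m \<in> M \<Longrightarrow> Poly_Mapping.keys m \<subseteq> V"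
    and M: "\<And>m e. m \<in> M \<Longrightarrow> Poly_Mapping.keys e \<subseteq> V \<Longrightarrow> e + m \<in> M"
  shows "ideal {p :: 'k::field mpoly. Poly_Mapping.keys p \<subseteq> M} (mpoly_ring V)"
  unfolding mpoly_ring_def
proof (rule idealI_subring_of_type)
  show "cring (subring_of_type {p :: 'k mpoly. \<forall>m\<in>Poly_Mapping.keys p. Poly_Mapping.keys m \<subseteq> V})"
    using cring_mpoly_ring unfolding mpoly_ring_def .
next
  fix p q :: "'k mpoly"
  assume "p \<in> {p. Poly_Mapping.keys p \<subseteq> M}" "q \<in> {p. Poly_Mapping.keys p \<subseteq> M}"
  then show "p + q \<in> {p. Poly_Mapping.keys p \<subseteq> M}"
    using Poly_Mapping.keys_add[of p q] by auto
next
  fix q p :: "'k mpoly"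
  assume q: "q \<in> {p. \<forall>m\<in>Poly_Mapping.keys p. Poly_Mapping.keys m \<subseteq> V}"
    and p: "p \<in> {p. Poly_Mapping.keys p \<subseteq> M}"
  show "q * p \<in> {p. Poly_Mapping.keys p \<subseteq> M}"
  proof clarify
    fix m assume "m \<in> Poly_Mapping.keys (q * p)"
    then obtain a b where "m = a + b" "a \<in> Poly_Mapping.keys q" "b \<in> Poly_Mapping.keys p"
      using keys_mult[of q p] by blast
    then show "m \<in> M" using p q M[of b a] by auto
  qed
qed (use assms(1) in auto)

lemma mem_ideal_if_monomials_mem:
  fixes p :: "'k::field mpoly"
  assumes Q: "ideal Q (mpoly_ring V)"
    and p: "\<And>m. m \<in> Poly_Mapping.keys p \<Longrightarrow> Poly_Mapping.single m 1 \<in> Q"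
  shows "p \<in> Q"
proof -
  interpret ideal Q "mpoly_ring V" by fact
  have "(\<Sum>m\<in>S. Poly_Mapping.single m (Poly_Mapping.lookup p m)) \<in> Q"
    if "finite S" "S \<subseteq> Poly_Mapping.keys p" for S
    using that
  proof (induction S rule: finite_induct)
    case empty
    then show ?case using additive_subgroup.zero_closed[OF is_additive_subgroup] by simp
  next
    case (insert m S)
    have "Poly_Mapping.single 0 (Poly_Mapping.lookup p m) \<otimes>\<^bsub>mpoly_ring V\<^esub> Poly_Mapping.single m 1 \<in> Q"
      using insert.prems by (intro I_l_closed p) auto
    then have "Poly_Mapping.single m (Poly_Mapping.lookup p m) \<in> Q" by (simp add: mult_single)
    then show ?case
      using insert additive_subgroup.a_closed[OF is_additive_subgroup] by fastforce
  qed
  from this[of "Poly_Mapping.keys p"] have "part p UNIV \<in> Q" by (simp add: part_def)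
  moreover have "part p UNIV = p" by (rule poly_mapping_eqI) (simp add: lookup_part)
  ultimately show ?thesis by simp
qed

text \<open>The fractions with numerator in Q and denominator outside P form an ideal containing the
  image of Q, which gives one direction. In the other, s is inverted. In a domain, equality of
  fractions is cross multiplication, so no further multiplier appears.\<close>

lemma mem_localized_ideal_iff:
  fixes A :: "'a::idom set"
  assumes P: "primeideal P (subring_of_type A)" and Q: "ideal Q (subring_of_type A)" and f: "f \<in> A"
  shows "Fract f 1 \<in> Idl\<^bsub>localization (subring_of_type A) P\<^esub> ((\<lambda>g. Fract g 1) ` Q)
    \<longleftrightarrow> (\<exists>s\<in>A - P. s * f \<in> Q)"
proof -
  let ?R = "subring_of_type A"
  let ?L = "localization ?R P"
  interpret P: primeideal P ?R by fact
  interpret Q: ideal Q ?R by fact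
  interpret L: cring ?L using P by (rule cring_localization)
  have L: "?L = subring_of_type {Fract a s | a s. a \<in> A \<and> s \<in> A - P}"
    by (simp add: localization_def)
  have one: "1 \<in> A - P"
    using P.one_closed P.I_notcarr P.one_imp_carrier by auto
  have nz: "s \<noteq> 0" if "s \<in> A - P" for s
    using that additive_subgroup.zero_closed[OF P.is_additive_subgroup] by auto
  have multP: "a * b \<in> A - P" if "a \<in> A - P" "b \<in> A - P" for a b
    using that P.I_prime[of a b] P.m_closed[of a b] by auto
  have QA: "a \<in> A" if "a \<in> Q" for a using Q.Icarr[OF that] by simp
  have sub: "(\<lambda>g. Fract g 1) ` Q \<subseteq> carrier ?L" unfolding L using one QA by auto
  show ?thesis
  proof
    let ?Q = "{Fract a s | a s. a \<in> Q \<and> s \<in> A - P}"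
    have "ideal ?Q ?L"
      unfolding L
    proof (rule idealI_subring_of_type)
      show "cring (subring_of_type {Fract a s |a s. a \<in> A \<and> s \<in> A - P})"
        using L.is_cring by (simp add: L)
      show "?Q \<subseteq> {Fract a s |a s. a \<in> A \<and> s \<in> A - P}" using QA by blast
      show "0 \<in> ?Q"
        using additive_subgroup.zero_closed[OF Q.is_additive_subgroup] one Zero_fract_def by auto
    next
      fix x y assume "x \<in> ?Q" "y \<in> ?Q"
      then obtain a s b u where *: "x = Fract a s" "y = Fract b u" "a \<in> Q" "s \<in> A - P" "b \<in> Q" "u \<in> A - P"
        by blast
      then have "x + y = Fract (a * u + b * s) (s * u)" using nz by auto
      moreover have "a * u + b * s \<in> Q"
        using * Q.I_r_closed[of a u] Q.I_r_closed[of b s] Q.a_closed by auto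
      ultimately show "x + y \<in> ?Q" using multP * by blast
    next
      fix x y assume "x \<in> {Fract a s |a s. a \<in> A \<and> s \<in> A - P}" "y \<in> ?Q"
      then obtain a s b u where *: "x = Fract a s" "y = Fract b u" "a \<in> A" "s \<in> A - P" "b \<in> Q" "u \<in> A - P"
        by blast
      then have "x * y = Fract (a * b) (s * u)" by auto
      moreover have "a * b \<in> Q" using * Q.I_l_closed[of b a] by auto
      ultimately show "x * y \<in> ?Q" using multP * by blast
    qed
    moreover have "(\<lambda>g. Fract g 1) ` Q \<subseteq> ?Q" using one by blast
    ultimately have "Idl\<^bsub>?L\<^esub> ((\<lambda>g. Fract g 1) ` Q) \<subseteq> ?Q" by (rule L.genideal_minimal)
    moreover assume "Fract f 1 \<in> Idl\<^bsub>?L\<^esub> ((\<lambda>g. Fract g 1) ` Q)"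
    ultimately obtain a s where as: "Fract f 1 = Fract a s" "a \<in> Q" "s \<in> A - P" by blast
    then have "f * s = a" using nz[of s] by (simp add: eq_fract)
    then show "\<exists>s\<in>A - P. s * f \<in> Q" using as by (auto simp: mult.commute)
  next
    assume "\<exists>s\<in>A - P. s * f \<in> Q"
    then obtain s where s: "s \<in> A - P" "s * f \<in> Q" by blast
    interpret J: ideal "Idl\<^bsub>?L\<^esub> ((\<lambda>g. Fract g 1) ` Q)" ?L using sub by (rule L.genideal_ideal)
    have "Fract (s * f) 1 \<in> Idl\<^bsub>?L\<^esub> ((\<lambda>g. Fract g 1) ` Q)"
      using L.genideal_self[OF sub] s(2) by blast
    moreover have "Fract 1 s \<in> carrier ?L" unfolding L using s one by auto
    ultimately have "Fract 1 s \<otimes>\<^bsub>?L\<^esub> Fract (s * f) 1 \<in> Idl\<^bsub>?L\<^esub> ((\<lambda>g. Fract g 1) ` Q)"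
      by (rule J.I_l_closed)
    moreover have "Fract 1 s * Fract (s * f) 1 = Fract f 1" using nz[OF s(1)] by (simp add: eq_fract)
    ultimately show "Fract f 1 \<in> Idl\<^bsub>?L\<^esub> ((\<lambda>g. Fract g 1) ` Q)" by (simp add: L)
  qed
qed

text \<open>This is the contraction of the localized ideal. Knowing that it is an ideal allows
  membership to be tested on monomials.\<close>

lemma ideal_saturation:
  fixes A :: "'a::idom set"
  assumes P: "primeideal P (subring_of_type A)" and Q: "ideal Q (subring_of_type A)"
  shows "ideal {f \<in> A. \<exists>s\<in>A - P. s * f \<in> Q} (subring_of_type A)"
proof -
  let ?R = "subring_of_type A"
  interpret P: primeideal P ?R by fact
  interpret Q: ideal Q ?R by fact
  have multP: "a * b \<in> A - P" if "a \<in> A - P" "b \<in> A - P" for a b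
    using that P.I_prime[of a b] P.m_closed[of a b] by auto
  have one: "1 \<in> A - P"
    using P.one_closed P.I_notcarr P.one_imp_carrier by auto
  show ?thesis
  proof (rule idealI_subring_of_type)
    show "cring ?R" by (rule P.is_cring)
    show "0 \<in> {f \<in> A. \<exists>s\<in>A - P. s * f \<in> Q}"
      using one P.zero_closed additive_subgroup.zero_closed[OF Q.is_additive_subgroup] by auto
  next
    fix f g assume "f \<in> {f \<in> A. \<exists>s\<in>A - P. s * f \<in> Q}" "g \<in> {f \<in> A. \<exists>s\<in>A - P. s * f \<in> Q}"
    then obtain s u where *: "f \<in> A" "g \<in> A" "s \<in> A - P" "u \<in> A - P" "s * f \<in> Q" "u * g \<in> Q" by blast
    have "u * (s * f) + s * (u * g) \<in> Q"
      using * Q.I_l_closed[of "s * f" u] Q.I_l_closed[of "u * g" s] Q.a_closed by auto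
    then have "(s * u) * (f + g) \<in> Q" by (simp add: algebra_simps)
    then show "f + g \<in> {f \<in> A. \<exists>s\<in>A - P. s * f \<in> Q}"
      using * multP[of s u] P.a_closed[of f g] by auto
  next
    fix r f assume "r \<in> A" "f \<in> {f \<in> A. \<exists>s\<in>A - P. s * f \<in> Q}"
    then obtain s where *: "r \<in> A" "f \<in> A" "s \<in> A - P" "s * f \<in> Q" by blast
    have "s * (r * f) \<in> Q" using * Q.I_l_closed[of "s * f" r] by (simp add: mult.left_commute)
    then show "r * f \<in> {f \<in> A. \<exists>s\<in>A - P. s * f \<in> Q}" using * P.m_closed[of r f] by auto
  qed auto
qed

section \<open>Counting minimal generators by linear algebra\<close>

lemma part_single_0_mult:
  fixes p :: "'k::field mpoly"
  shows "part (Poly_Mapping.single 0 c * p) A = Poly_Mapping.single 0 c * part p A"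
proof (rule poly_mapping_eqI)
  fix m
  have "Poly_Mapping.lookup (Poly_Mapping.single 0 c * q) m = c * Poly_Mapping.lookup q m" for q :: "'k mpoly"
    by (simp add: Poly_Mapping.map.rep_eq when_def flip: mult_map_scale_conv_mult)
  then show "Poly_Mapping.lookup (part (Poly_Mapping.single 0 c * p) A) m
      = Poly_Mapping.lookup (Poly_Mapping.single 0 c * part p A) m"
    by (simp add: lookup_part)
qed

lemma vector_space_poly_mapping:
  "vector_space (\<lambda>c p. Poly_Mapping.single 0 c * p :: 'k::field mpoly)"
  by unfold_locales (simp_all add: distrib_left distrib_right single_add mult_single flip: mult.assoc)

text \<open>Modulo the ideal of \<open>M\<close>, the ideal of \<open>M \<union> G\<close> is annihilated by all monomials other than \<open>1\<close>, so it is
  the vector space with basis \<open>G\<close>.\<close>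

lemma card_minimal_monomial_generators:
  fixes V :: "nat set" and M G :: "(nat \<Rightarrow>\<^sub>0 nat) set"
  defines "R \<equiv> mpoly_ring V :: ('k::field) mpoly ring"
  assumes MV: "\<And>m. m \<in> M \<Longrightarrow> Poly_Mapping.keys m \<subseteq> V"
    and GV: "\<And>m. m \<in> G \<Longrightarrow> Poly_Mapping.keys m \<subseteq> V"
    and M: "\<And>m e. m \<in> M \<Longrightarrow> Poly_Mapping.keys e \<subseteq> V \<Longrightarrow> e + m \<in> M"
    and G: "\<And>m e. m \<in> G \<Longrightarrow> Poly_Mapping.keys e \<subseteq> V \<Longrightarrow> e \<noteq> 0 \<Longrightarrow> e + m \<in> M"
    and disj: "M \<inter> G = {}" and fin: "finite G"
  shows "(LEAST k. \<exists>Fs. length Fs = k \<and> set Fs \<subseteq> carrier R \<and>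
      {p. Poly_Mapping.keys p \<subseteq> M \<union> G} = {p. Poly_Mapping.keys p \<subseteq> M} <+>\<^bsub>R\<^esub> Idl\<^bsub>R\<^esub> (set Fs)) = card G"
proof (rule Least_equality)
  let ?J = "{p :: 'k mpoly. Poly_Mapping.keys p \<subseteq> M \<union> G}"
  let ?M = "{p :: 'k mpoly. Poly_Mapping.keys p \<subseteq> M}"
  let ?x = "\<lambda>m. Poly_Mapping.single m 1 :: 'k mpoly"
  interpret R: cring R unfolding R_def by (rule cring_mpoly_ring)
  have J: "ideal ?J R"
    unfolding R_def
  proof (rule monomial_ideal)
    fix m e :: "nat \<Rightarrow>\<^sub>0 nat" assume "m \<in> M \<union> G" "Poly_Mapping.keys e \<subseteq> V"
    then show "e + m \<in> M \<union> G" using M[of m e] G[of m e] by (cases "e = 0") auto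
  qed (use MV GV in blast)
  have add: "A <+>\<^bsub>R\<^esub> B = {a + b | a b. a \<in> A \<and> b \<in> B}" for A B
    by (auto simp: set_add_def' R_def)
  obtain gs where gs: "set gs = G" "distinct gs" using finite_distinct_list[OF fin] by blast
  show "\<exists>Fs. length Fs = card G \<and> set Fs \<subseteq> carrier R \<and> ?J = ?M <+>\<^bsub>R\<^esub> Idl\<^bsub>R\<^esub> (set Fs)"
  proof (intro exI[of _ "map ?x gs"] conjI)
    show "length (map ?x gs) = card G" using gs distinct_card by fastforce
    show sub: "set (map ?x gs) \<subseteq> carrier R" using gs(1) GV by (fastforce simp: R_def)
    let ?K = "Idl\<^bsub>R\<^esub> (set (map ?x gs))"
    have K: "ideal ?K R" using sub by (rule R.genideal_ideal)
    have "?K \<subseteq> ?J" using gs by (intro R.genideal_minimal J) auto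
    show "?J = ?M <+>\<^bsub>R\<^esub> ?K"
    proof
      show "?M <+>\<^bsub>R\<^esub> ?K \<subseteq> ?J"
      proof
        fix p assume "p \<in> ?M <+>\<^bsub>R\<^esub> ?K"
        then obtain a b where "p = a + b" "a \<in> ?M" "b \<in> ?J" using \<open>?K \<subseteq> ?J\<close> by (auto simp: add)
        then show "p \<in> ?J" using Poly_Mapping.keys_add[of a b] by auto
      qed
      show "?J \<subseteq> ?M <+>\<^bsub>R\<^esub> ?K"
      proof
        fix p assume p: "p \<in> ?J"
        have "part p (- M) \<in> ?K"
        proof (rule mem_ideal_if_monomials_mem)
          show "ideal ?K (mpoly_ring V)" using K by (simp only: R_def)
          fix m assume "m \<in> Poly_Mapping.keys (part p (- M))"
          then have "?x m \<in> set (map ?x gs)" using p gs by (auto simp: keys_part)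
          then show "?x m \<in> ?K" using R.genideal_self[OF sub] by blast
        qed
        moreover have "part p M \<in> ?M" by (simp add: keys_part)
        ultimately show "p \<in> ?M <+>\<^bsub>R\<^esub> ?K" unfolding add using part_add_Compl[of p M, symmetric] by blast
      qed
    qed
  qed
next
  let ?J = "{p :: 'k mpoly. Poly_Mapping.keys p \<subseteq> M \<union> G}"
  let ?M = "{p :: 'k mpoly. Poly_Mapping.keys p \<subseteq> M}"
  let ?x = "\<lambda>m. Poly_Mapping.single m 1 :: 'k mpoly"
  let ?A = "{p :: 'k mpoly. \<forall>m\<in>Poly_Mapping.keys p. Poly_Mapping.keys m \<subseteq> V}"
  interpret R: cring R unfolding R_def by (rule cring_mpoly_ring)
  interpret vector_space "\<lambda>c p. Poly_Mapping.single 0 c * p :: 'k mpoly" by (rule vector_space_poly_mapping)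
  fix k assume "\<exists>Fs. length Fs = k \<and> set Fs \<subseteq> carrier R \<and> ?J = ?M <+>\<^bsub>R\<^esub> Idl\<^bsub>R\<^esub> (set Fs)"
  then obtain Fs where Fs: "length Fs = k" "set Fs \<subseteq> carrier R" "?J = ?M <+>\<^bsub>R\<^esub> Idl\<^bsub>R\<^esub> (set Fs)"
    by blast
  have add: "A <+>\<^bsub>R\<^esub> B = {a + b | a b. a \<in> A \<and> b \<in> B}" for A B
    by (auto simp: set_add_def' R_def)
  \<comment> \<open>Every nonconstant term of r moves the monomials of p into M, which is disjoint
    from G.\<close>
  have part_mult: "part (r * p) G = Poly_Mapping.single 0 (Poly_Mapping.lookup r 0) * part p G"
    if r: "r \<in> ?A" and p: "p \<in> ?J" for r p
  proof -
    have "m \<notin> G" if m: "m \<in> Poly_Mapping.keys (part r (- {0}) * p)" for m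
    proof -
      obtain a b where "m = a + b" "a \<in> Poly_Mapping.keys r" "a \<noteq> 0" "b \<in> Poly_Mapping.keys p"
        using m keys_mult[of "part r (- {0})" p] by (fastforce simp: keys_part)
      then have "m \<in> M" using r p M[of b a] G[of b a] by auto
      then show ?thesis using disj by blast
    qed
    then have "Poly_Mapping.keys (part (part r (- {0}) * p) G) = {}" by (auto simp: keys_part)
    then have "part (part r (- {0}) * p) G = 0" by simp
    moreover have "part r {0} = Poly_Mapping.single 0 (Poly_Mapping.lookup r 0)"
      by (rule poly_mapping_eqI) (auto simp: lookup_part lookup_single when_def)
    moreover have "r * p = part r {0} * p + part r (- {0}) * p"
      by (simp add: part_add_Compl flip: distrib_right)
    ultimately show ?thesis by (simp add: part_add part_single_0_mult)
  qed
  let ?S = "span ((\<lambda>p. part p G) ` set Fs)"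
  \<comment> \<open>By \<open>part_mult\<close> this is an ideal. It contains each F, because 0 + F
    lies in the sum, and so contains the ideal they generate. Thus the \<open>G\<close>-parts of the
    F span all \<open>G\<close>-parts.\<close>
  let ?L = "{p \<in> ?J. part p G \<in> ?S}"
  have JA: "?J \<subseteq> ?A" using MV GV by blast
  have "ideal ?L R"
    unfolding R_def mpoly_ring_def
  proof (rule idealI_subring_of_type)
    show "cring (subring_of_type ?A)" using R.is_cring unfolding R_def mpoly_ring_def .
    show "?L \<subseteq> ?A" using JA by blast
    have "part 0 G = (0 :: 'k mpoly)" by (rule poly_mapping_eqI) (simp add: lookup_part)
    then show "0 \<in> ?L" using span_zero by simp
    fix a b assume ab: "a \<in> ?L" "b \<in> ?L"
    then have "a + b \<in> ?J" using Poly_Mapping.keys_add[of a b] by auto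
    then show "a + b \<in> ?L" using ab span_add by (simp add: part_add)
  next
    fix r a assume r: "r \<in> ?A" and a: "a \<in> ?L"
    have "r * a \<in> ?J"
    proof clarify
      fix m assume "m \<in> Poly_Mapping.keys (r * a)" "m \<notin> G"
      then obtain b c where "m = b + c" "b \<in> Poly_Mapping.keys r" "c \<in> Poly_Mapping.keys a"
        using keys_mult[of r a] by blast
      then show "m \<in> M" using r a M[of c b] G[of c b] \<open>m \<notin> G\<close> by (cases "b = 0") auto
    qed
    then show "r * a \<in> ?L" using a part_mult[OF r, of a] span_scale by simp
  qed
  moreover have "set Fs \<subseteq> ?L"
  proof
    fix F assume F: "F \<in> set Fs"
    then have "F \<in> Idl\<^bsub>R\<^esub> (set Fs)" using R.genideal_self[OF Fs(2)] by blast
    moreover have "(0 :: 'k mpoly) \<in> ?M" by simp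
    ultimately have "0 + F \<in> ?J" unfolding Fs(3) add by blast
    then show "F \<in> ?L" using F by (simp add: span_base)
  qed
  ultimately have IL: "Idl\<^bsub>R\<^esub> (set Fs) \<subseteq> ?L" by (rule R.genideal_minimal)
  have JL: "part p G \<in> ?S" if "p \<in> ?J" for p
  proof -
    have "p \<in> ?M <+>\<^bsub>R\<^esub> Idl\<^bsub>R\<^esub> (set Fs)" using that by (simp only: Fs(3))
    then obtain a b where ab: "p = a + b" "a \<in> ?M" "b \<in> Idl\<^bsub>R\<^esub> (set Fs)" unfolding add by blast
    then have "b \<in> ?L" using IL by blast
    have "Poly_Mapping.keys (part a G) = {}" using ab(2) disj by (auto simp: keys_part)
    then show ?thesis using ab \<open>b \<in> ?L\<close> by (simp add: part_add)
  qed
  have "?x ` G \<subseteq> ?S"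
  proof clarify
    fix g assume "g \<in> G"
    then have "part (?x g) G = ?x g"
      by (intro poly_mapping_eqI) (auto simp: lookup_part lookup_single when_def)
    then show "?x g \<in> ?S" using JL[of "?x g"] \<open>g \<in> G\<close> by simp
  qed
  moreover have x_eq: "?x a = ?x b \<longleftrightarrow> a = b" for a b
  proof
    assume "?x a = ?x b"
    then have "Poly_Mapping.keys (?x a) = Poly_Mapping.keys (?x b)" by (rule arg_cong)
    then show "a = b" by simp
  qed simp
  have "independent (?x ` G)"
    unfolding dependent_explicit
  proof clarify
    fix S u v
    assume S: "finite S" "S \<subseteq> ?x ` G" "(\<Sum>v\<in>S. Poly_Mapping.single 0 (u v) * v) = 0" and v: "v \<in> S" "u v \<noteq> 0"
    obtain g where g: "v = ?x g" using S v by blast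
    have "Poly_Mapping.lookup (\<Sum>w\<in>S. Poly_Mapping.single 0 (u w) * w) g = (\<Sum>w\<in>S. if w = v then u w else 0)"
      unfolding lookup_sum
    proof (intro sum.cong refl)
      fix w assume "w \<in> S"
      then obtain h where "w = ?x h" using S by blast
      then show "Poly_Mapping.lookup (Poly_Mapping.single 0 (u w) * w) g = (if w = v then u w else 0)"
        by (simp add: g mult_single lookup_single when_def x_eq)
    qed
    then show False using S v by simp
  qed
  ultimately have "card (?x ` G) \<le> card ((\<lambda>p. part p G) ` set Fs)"
    using independent_span_bound[of "(\<lambda>p. part p G) ` set Fs" "?x ` G"] by simp
  also have "\<dots> \<le> card (set Fs)" by (simp add: card_image_le)
  also have "\<dots> \<le> k" using card_length[of Fs] Fs(1) by simp
  finally have "card (?x ` G) \<le> k" .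
  moreover have "inj_on ?x G" by (rule inj_onI) (simp only: x_eq)
  ultimately show "card G \<le> k" by (simp add: card_image)
qed


section \<open>Symbolic powers of edge ideals\<close>

locale simple_graph =
  fixes V :: "nat set" and E :: "nat set set"
  assumes finite_V: "finite V"
    and edgeD: "e \<in> E \<Longrightarrow> \<exists>i\<in>V. \<exists>j\<in>V. i \<noteq> j \<and> e = {i, j}"
begin

text \<open>The exponent vectors of the monomials divisible by a product of \<open>k\<close> edges.\<close>

fun edge_exps :: "nat \<Rightarrow> (nat \<Rightarrow>\<^sub>0 nat) set" where
  "edge_exps 0 = {m. Poly_Mapping.keys m \<subseteq> V}"
| "edge_exps (Suc k) =
    {Poly_Mapping.single i 1 + Poly_Mapping.single j 1 + m | i j m. {i, j} \<in> E \<and> m \<in> edge_exps k}"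

lemmas edge_exps_Suc = edge_exps.simps(2)

declare edge_exps_Suc [simp del]

definition vertex_cover :: "nat set \<Rightarrow> bool" where
  "vertex_cover W \<longleftrightarrow> W \<subseteq> V \<and> (\<forall>e\<in>E. e \<inter> W \<noteq> {})"

abbreviation R :: "('k::field) mpoly ring" where "R \<equiv> mpoly_ring V"

abbreviation I :: "('k::field) mpoly set" where "I \<equiv> edge_ideal V E"

lemma edge: "{i, j} \<in> E \<Longrightarrow> i \<in> V \<and> j \<in> V \<and> i \<noteq> j"
  using edgeD[of "{i, j}"] by (auto simp: doubleton_eq_iff)

lemma edge_exps_subset: "m \<in> edge_exps k \<Longrightarrow> Poly_Mapping.keys m \<subseteq> V"
proof (induction k arbitrary: m)
  case (Suc k)
  then obtain i j m' where *: "m = Poly_Mapping.single i 1 + Poly_Mapping.single j 1 + m'"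
    "{i, j} \<in> E" "m' \<in> edge_exps k" by (auto simp: edge_exps_Suc)
  then have "Poly_Mapping.keys m' \<subseteq> V" using Suc.IH by blast
  then show ?case using *(1) edge[OF *(2)] by (simp add: keys_plus_nat)
qed simp

text \<open>The case j = 0 says that \<open>edge_exps k\<close> is closed under multiplication by
  monomials in the variables V.\<close>

lemma edge_exps_add: "a \<in> edge_exps j \<Longrightarrow> b \<in> edge_exps k \<Longrightarrow> a + b \<in> edge_exps (j + k)"
proof (induction j arbitrary: a)
  case 0
  show ?case
    using 0(2)
  proof (induction k arbitrary: b)
    case 0 then show ?case using \<open>a \<in> edge_exps 0\<close> by (auto simp: keys_plus_nat)
  next
    case (Suc k)
    then obtain i j m where "b = Poly_Mapping.single i 1 + Poly_Mapping.single j 1 + m"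
      "{i, j} \<in> E" "m \<in> edge_exps k" by (auto simp: edge_exps_Suc)
    then have "a + b = Poly_Mapping.single i 1 + Poly_Mapping.single j 1 + (a + m)"
      "{i, j} \<in> E" "a + m \<in> edge_exps k" using Suc.IH[of m] by (auto simp: algebra_simps)
    then show ?case by (auto simp: edge_exps_Suc)
  qed
next
  case (Suc l)
  then obtain i j m where "a = Poly_Mapping.single i 1 + Poly_Mapping.single j 1 + m"
    "{i, j} \<in> E" "m \<in> edge_exps l" by (auto simp: edge_exps_Suc)
  then have "a + b = Poly_Mapping.single i 1 + Poly_Mapping.single j 1 + (m + b)"
    "{i, j} \<in> E" "m + b \<in> edge_exps (l + k)" using Suc.IH[of m] Suc.prems by (auto simp: algebra_simps)
  then show ?case by (auto simp: edge_exps_Suc)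
qed

text \<open>The ends of an edge are distinct, so divisibility by an edge depends on the support
  alone. The arguments about primes below compare supports.\<close>

lemma edge_exps_1:
  "m \<in> edge_exps 1 \<longleftrightarrow> Poly_Mapping.keys m \<subseteq> V \<and> (\<exists>i j. {i, j} \<in> E \<and> {i, j} \<subseteq> Poly_Mapping.keys m)"
proof
  assume m: "m \<in> edge_exps 1"
  then obtain i j m' where "m = Poly_Mapping.single i 1 + Poly_Mapping.single j 1 + m'" "{i, j} \<in> E"
    by (auto simp: edge_exps_Suc)
  then have "{i, j} \<subseteq> Poly_Mapping.keys m" by (auto simp: in_keys_iff lookup_add)
  then show "Poly_Mapping.keys m \<subseteq> V \<and> (\<exists>i j. {i, j} \<in> E \<and> {i, j} \<subseteq> Poly_Mapping.keys m)"
    using edge_exps_subset[OF m] \<open>{i, j} \<in> E\<close> by blast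
next
  assume "Poly_Mapping.keys m \<subseteq> V \<and> (\<exists>i j. {i, j} \<in> E \<and> {i, j} \<subseteq> Poly_Mapping.keys m)"
  then obtain i j where m: "Poly_Mapping.keys m \<subseteq> V" and ij: "{i, j} \<in> E" "{i, j} \<subseteq> Poly_Mapping.keys m"
    by blast
  let ?e = "Poly_Mapping.single i 1 + Poly_Mapping.single j (1::nat)"
  have "m = ?e + (m - ?e)"
    using ij edge[OF ij(1)]
    by (intro poly_mapping_eqI) (auto simp: lookup_add lookup_minus lookup_single when_def in_keys_iff)
  moreover have "Poly_Mapping.keys (m - ?e) \<subseteq> V"
    using m by (auto simp: in_keys_iff lookup_minus)
  ultimately show "m \<in> edge_exps 1" using ij(1) by (auto simp: edge_exps_Suc)
qed

lemma edge_mem_edge_exps: "{i, j} \<in> E \<Longrightarrow> Poly_Mapping.single i 1 + Poly_Mapping.single j 1 \<in> edge_exps 1"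
  unfolding edge_exps_1 using edge[of i j] by (auto simp: keys_plus_nat)

lemma ideal_edge_exps: "ideal {p :: 'k::field mpoly. Poly_Mapping.keys p \<subseteq> edge_exps k} R"
proof (rule monomial_ideal)
  fix m e :: "nat \<Rightarrow>\<^sub>0 nat"
  assume "m \<in> edge_exps k" "Poly_Mapping.keys e \<subseteq> V"
  then show "e + m \<in> edge_exps k" using edge_exps_add[of e 0 m k] by simp
qed (use edge_exps_subset in blast)

lemma edge_ideal_eq: "I = {p :: 'k::field mpoly. Poly_Mapping.keys p \<subseteq> edge_exps 1}"
proof
  interpret R: ring "R :: 'k mpoly ring" by (rule ring_mpoly_ring)
  have gen: "Var i * Var j = (Poly_Mapping.single (Poly_Mapping.single i 1 + Poly_Mapping.single j 1) 1 :: 'k mpoly)" for i j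
    by (simp add: Var_def mult_single)
  have sub: "{Var i * Var j |i j. {i, j} \<in> E} \<subseteq> {p :: 'k mpoly. Poly_Mapping.keys p \<subseteq> edge_exps 1}"
    using edge_mem_edge_exps by (auto simp: gen)
  then show "I \<subseteq> {p :: 'k mpoly. Poly_Mapping.keys p \<subseteq> edge_exps 1}"
    unfolding edge_ideal_def by (intro R.genideal_minimal ideal_edge_exps)
  have sub': "{Var i * Var j |i j. {i, j} \<in> E} \<subseteq> carrier (R :: 'k mpoly ring)"
    using sub edge_exps_subset by fastforce
  interpret I: ideal "I :: 'k mpoly set" R
    unfolding edge_ideal_def using sub' by (rule R.genideal_ideal)
  show "{p :: 'k mpoly. Poly_Mapping.keys p \<subseteq> edge_exps 1} \<subseteq> I"
  proof clarify
    fix p :: "'k mpoly" assume p: "Poly_Mapping.keys p \<subseteq> edge_exps 1"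
    show "p \<in> I"
    proof (rule mem_ideal_if_monomials_mem[OF I.ideal_axioms])
      fix m assume "m \<in> Poly_Mapping.keys p"
      then obtain i j m' where m: "m = Poly_Mapping.single i 1 + Poly_Mapping.single j 1 + m'"
        "{i, j} \<in> E" "Poly_Mapping.keys m' \<subseteq> V" using p by (auto simp: edge_exps_Suc)
      have "Var i * Var j \<in> (I :: 'k mpoly set)"
        unfolding edge_ideal_def using R.genideal_self[OF sub'] m(2) by blast
      then have "Poly_Mapping.single m' 1 \<otimes>\<^bsub>R\<^esub> (Var i * Var j) \<in> (I :: 'k mpoly set)"
        using m(3) by (intro I.I_l_closed) auto
      then show "Poly_Mapping.single m 1 \<in> (I :: 'k mpoly set)"
        by (simp add: gen mult_single m(1) add.commute)
    qed
  qed
qed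

lemma edge_ideal_power:
  "I [^]\<^bsub>ideals_set R\<^esub> k = {p :: 'k::field mpoly. Poly_Mapping.keys p \<subseteq> edge_exps k}"
proof (induction k)
  case 0
  show ?case by (auto simp: nat_pow_def ideals_set_def)
next
  case (Suc k)
  let ?J = "{p :: 'k mpoly. Poly_Mapping.keys p \<subseteq> edge_exps k}"
  interpret R: ring "R :: 'k mpoly ring" by (rule ring_mpoly_ring)
  have "I [^]\<^bsub>ideals_set R\<^esub> Suc k = ideal_prod R ?J (I :: 'k mpoly set)"
    unfolding Suc.IH[symmetric] by (simp add: nat_pow_def ideals_set_def)
  also have "\<dots> = {p. Poly_Mapping.keys p \<subseteq> edge_exps (Suc k)}"
  proof
    show "ideal_prod R ?J I \<subseteq> {p :: 'k mpoly. Poly_Mapping.keys p \<subseteq> edge_exps (Suc k)}"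
    proof
      fix p assume "p \<in> ideal_prod R ?J (I :: 'k mpoly set)"
      then have "Poly_Mapping.keys p \<subseteq> edge_exps (k + 1)"
      proof (induction p rule: ideal_prod.induct)
        case (prod p q)
        then show ?case
          using keys_mult[of p q] edge_exps_add[of _ k _ 1] unfolding edge_ideal_eq by fastforce
      next
        case (sum p q)
        then show ?case using Poly_Mapping.keys_add[of p q] by auto
      qed
      then show "p \<in> {p. Poly_Mapping.keys p \<subseteq> edge_exps (Suc k)}" by simp
    qed
    have J: "ideal (ideal_prod R ?J (I :: 'k mpoly set)) R"
      using ideal_edge_exps[of 1] by (intro R.ideal_prod_is_ideal ideal_edge_exps) (simp add: edge_ideal_eq)
    show "{p :: 'k mpoly. Poly_Mapping.keys p \<subseteq> edge_exps (Suc k)} \<subseteq> ideal_prod R ?J I"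
    proof clarify
      fix p :: "'k mpoly" assume p: "Poly_Mapping.keys p \<subseteq> edge_exps (Suc k)"
      show "p \<in> ideal_prod R ?J I"
      proof (rule mem_ideal_if_monomials_mem[OF J])
        fix m assume "m \<in> Poly_Mapping.keys p"
        then obtain i j m' where m: "m = Poly_Mapping.single i 1 + Poly_Mapping.single j 1 + m'"
          "{i, j} \<in> E" "m' \<in> edge_exps k" using p by (auto simp: edge_exps_Suc)
        let ?e = "Poly_Mapping.single i 1 + Poly_Mapping.single j 1"
        have "?e \<in> edge_exps 1" using m(2) by (rule edge_mem_edge_exps)
        then have "Poly_Mapping.single ?e 1 \<in> (I :: 'k mpoly set)" by (simp add: edge_ideal_eq)
        then have "Poly_Mapping.single m' 1 \<otimes>\<^bsub>R\<^esub> Poly_Mapping.single ?e 1 \<in> ideal_prod R ?J (I :: 'k mpoly set)"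
          using m(3) by (intro ideal_prod.prod) auto
        then show "Poly_Mapping.single m 1 \<in> ideal_prod R ?J (I :: 'k mpoly set)"
          by (simp add: mult_single m(1) add.commute)
      qed
    qed
  qed
  finally show ?case .
qed

section \<open>Vertex covers and associated primes\<close>

lemma finite_cover: "vertex_cover W \<Longrightarrow> finite W"
  using finite_V finite_subset by (auto simp: vertex_cover_def)

lemma edge_exps_cover:
  assumes W: "vertex_cover W"
  shows "m \<in> edge_exps k \<Longrightarrow> k \<le> (\<Sum>v\<in>W. Poly_Mapping.lookup m v)"
proof (induction k arbitrary: m)
  case (Suc k)
  then obtain i j m' where m: "m = Poly_Mapping.single i 1 + Poly_Mapping.single j 1 + m'"
    "{i, j} \<in> E" "m' \<in> edge_exps k" by (auto simp: edge_exps_Suc)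
  have "i \<in> W \<or> j \<in> W" using W m(2) by (auto simp: vertex_cover_def)
  then have "1 \<le> (\<Sum>v\<in>W. (if v = i then 1 else 0) + (if v = j then 1 else 0 :: nat))"
    using finite_cover[OF W] by (auto simp: sum.distrib)
  moreover have "(\<Sum>v\<in>W. Poly_Mapping.lookup m v)
      = (\<Sum>v\<in>W. (if v = i then 1 else 0) + (if v = j then 1 else 0)) + (\<Sum>v\<in>W. Poly_Mapping.lookup m' v)"
    unfolding sum.distrib[symmetric] m(1)
    by (intro sum.cong) (auto simp: lookup_add lookup_single when_def)
  ultimately show ?case using Suc.IH[OF m(3)] by linarith
qed simp

text \<open>If v cannot be removed from the cover, some edge meets the cover in v only.\<close>

lemma minimal_cover:
  assumes "vertex_cover W"
  obtains W' where "W' \<subseteq> W" "vertex_cover W'" "\<And>v. v \<in> W' \<Longrightarrow> \<exists>u. {v, u} \<in> E \<and> u \<in> V - W'"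
proof -
  let ?S = "{U. U \<subseteq> W \<and> vertex_cover U}"
  have "finite ?S" using finite_cover[OF assms] by simp
  moreover have "?S \<noteq> {}" using assms by blast
  ultimately have "\<exists>W'\<in>?S. \<forall>U\<in>?S. U \<le> W' \<longrightarrow> W' = U" by (rule finite_has_minimal)
  then obtain W' where "W' \<in> ?S" and min: "\<forall>U\<in>?S. U \<le> W' \<longrightarrow> W' = U" by (rule bexE)
  then have W': "W' \<subseteq> W" "vertex_cover W'" by simp_all
  have "\<exists>u. {v, u} \<in> E \<and> u \<in> V - W'" if v: "v \<in> W'" for v
  proof -
    have "\<not> vertex_cover (W' - {v})"
    proof
      assume "vertex_cover (W' - {v})"
      then have "W' - {v} \<in> ?S" using W' by auto
      from bspec[OF min this] have "W' = W' - {v}" by auto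
      then show False using v by blast
    qed
    then obtain e where e: "e \<in> E" "e \<inter> (W' - {v}) = {}"
      using W' by (auto simp: vertex_cover_def)
    then have "v \<in> e" using W' by (auto simp: vertex_cover_def)
    moreover obtain i j where ij: "i \<in> V" "j \<in> V" "i \<noteq> j" "e = {i, j}" using edgeD[OF e(1)] by blast
    ultimately have "v = i \<or> v = j" by blast
    then show ?thesis
    proof
      assume "v = i"
      then show ?thesis using e ij by (intro exI[of _ j]) auto
    next
      assume "v = j"
      then show ?thesis using e ij by (intro exI[of _ i]) (auto simp: insert_commute)
    qed
  qed
  then show thesis by (rule that[OF W'])
qed

text \<open>The prime ideal generated by a minimal cover annihilates the product of the variables outside
  the cover.\<close>

lemma minimal_cover_associated:
  assumes W: "vertex_cover W" and min: "\<And>v. v \<in> W \<Longrightarrow> \<exists>u. {v, u} \<in> E \<and> u \<in> V - W"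
  shows "{p :: 'k::field mpoly. Poly_Mapping.keys p \<subseteq> {m. Poly_Mapping.keys m \<subseteq> V \<and> Poly_Mapping.keys m \<inter> W \<noteq> {}}}
    \<in> associated_primes R I" (is "?P \<in> _")
proof -
  let ?M = "{m. Poly_Mapping.keys m \<subseteq> V \<and> Poly_Mapping.keys m \<inter> W \<noteq> {}}"
  have P: "ideal ?P R"
    by (rule monomial_ideal) (auto simp: keys_plus_nat)
  have prime: "primeideal ?P (R :: 'k mpoly ring)"
  proof (rule primeidealI[OF P cring_mpoly_ring])
    have "(1 :: 'k mpoly) \<notin> ?P" by auto
    moreover have "(1 :: 'k mpoly) \<in> carrier R" by auto
    ultimately show "carrier R \<noteq> ?P" by blast
    fix a b :: "'k mpoly"
    assume ab: "a \<in> carrier R" "b \<in> carrier R" "a \<otimes>\<^bsub>R\<^esub> b \<in> ?P"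
    \<comment> \<open>The candidate prime consists of the polynomials whose terms all have positive
      degree in the variables of W. If b has a term of degree 0, \<open>weight_ge_of_mult\<close>
      cancels b from the product.\<close>
    let ?w = "\<lambda>m. \<Sum>v\<in>W. Poly_Mapping.lookup m v"
    have w: "1 \<le> ?w m \<longleftrightarrow> Poly_Mapping.keys m \<inter> W \<noteq> {}" for m :: "nat \<Rightarrow>\<^sub>0 nat"
    proof -
      have "?w m = 0 \<longleftrightarrow> Poly_Mapping.keys m \<inter> W = {}"
        using finite_cover[OF W] by (auto simp: in_keys_iff)
      then show ?thesis by linarith
    qed
    show "a \<in> ?P \<or> b \<in> ?P"
    proof (rule disjCI)
      assume "b \<notin> ?P"
      then obtain m\<^sub>0 where m0: "m\<^sub>0 \<in> Poly_Mapping.keys b" "\<not> 1 \<le> ?w m\<^sub>0"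
        using ab(2) unfolding w by fastforce
      have "1 \<le> ?w m" if m: "m \<in> Poly_Mapping.keys a" for m
      proof (rule weight_ge_of_mult[of ?w])
        show "m\<^sub>0 \<in> Poly_Mapping.keys b" "?w m\<^sub>0 = 0" using m0 by auto
        show "\<And>k. k \<in> Poly_Mapping.keys (b * a) \<Longrightarrow> 1 \<le> ?w k"
          using ab(3) unfolding w by (auto simp: mult.commute)
        show "m \<in> Poly_Mapping.keys a" by fact
      qed (simp add: lookup_add sum.distrib)
      then show "a \<in> ?P" using ab(1) unfolding w by auto
    qed
  qed
  define c :: "nat \<Rightarrow>\<^sub>0 nat" where "c = (\<Sum>v\<in>V - W. Poly_Mapping.single v 1)"
  have "Poly_Mapping.lookup c v = (\<Sum>x\<in>V - W. if x = v then 1 else 0)" for v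
    unfolding c_def lookup_sum by (intro sum.cong) (simp_all add: lookup_single when_def)
  then have c: "Poly_Mapping.keys c = V - W"
    using finite_V by (auto simp: in_keys_iff split: if_splits)
  \<comment> \<open>No edge lies inside V - W because W is a cover, while each v in W has a
    neighbour there by minimality.\<close>
  have iff: "c + m \<in> edge_exps 1 \<longleftrightarrow> Poly_Mapping.keys m \<inter> W \<noteq> {}" if m: "Poly_Mapping.keys m \<subseteq> V" for m
  proof
    assume "c + m \<in> edge_exps 1"
    then obtain i j where "{i, j} \<in> E" "{i, j} \<subseteq> (V - W) \<union> Poly_Mapping.keys m"
      unfolding edge_exps_1 keys_plus_nat c by blast
    then show "Poly_Mapping.keys m \<inter> W \<noteq> {}" using W by (fastforce simp: vertex_cover_def)
  next
    assume "Poly_Mapping.keys m \<inter> W \<noteq> {}"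
    then obtain v u where "v \<in> Poly_Mapping.keys m" "{v, u} \<in> E" "u \<in> V - W" using min by blast
    then show "c + m \<in> edge_exps 1" unfolding edge_exps_1 keys_plus_nat c using m by blast
  qed
  have "r \<in> ?P \<longleftrightarrow> r \<in> carrier R \<and> r \<otimes>\<^bsub>R\<^esub> Poly_Mapping.single c 1 \<in> I" for r :: "'k mpoly"
  proof -
    have "r \<otimes>\<^bsub>R\<^esub> Poly_Mapping.single c 1 \<in> I \<longleftrightarrow> (\<forall>m\<in>Poly_Mapping.keys r. c + m \<in> edge_exps 1)"
      unfolding edge_ideal_eq by (auto simp: mult.commute[of r] keys_single_mult)
    moreover have "r \<in> carrier R \<longleftrightarrow> (\<forall>m\<in>Poly_Mapping.keys r. Poly_Mapping.keys m \<subseteq> V)" by simp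
    ultimately show ?thesis using iff by blast
  qed
  then have "?P = {r \<in> carrier R. r \<otimes>\<^bsub>R\<^esub> Poly_Mapping.single c 1 \<in> I}" by blast
  moreover have "Poly_Mapping.single c 1 \<in> carrier (R :: 'k mpoly ring)" using c by auto
  ultimately show ?thesis using prime unfolding associated_primes_def by blast
qed

context
  fixes P :: "('k::field) mpoly set"
  assumes P: "P \<in> associated_primes R I"
begin

lemma associated_prime: "primeideal P R"
  using P by (simp add: associated_primes_def)

text \<open>P annihilates some f modulo I, hence contains I. Being prime, it contains an end of
  every edge.\<close>

lemma associated_cover: "vertex_cover {v \<in> V. Var v \<in> P}"
proof -
  interpret P: primeideal P R by (rule associated_prime)
  obtain f where f: "f \<in> carrier R" "P = {r \<in> carrier R. r \<otimes>\<^bsub>R\<^esub> f \<in> I}"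
    using P unfolding associated_primes_def by blast
  interpret I: ideal "I :: 'k mpoly set" R using ideal_edge_exps[of 1] by (simp add: edge_ideal_eq)
  have "e \<inter> {v \<in> V. Var v \<in> P} \<noteq> {}" if e: "e \<in> E" for e
  proof -
    obtain i j where ij: "i \<in> V" "j \<in> V" "i \<noteq> j" "e = {i, j}" using edgeD[OF e] by blast
    have "Poly_Mapping.single i 1 + Poly_Mapping.single j 1 \<in> edge_exps 1"
      using ij e edge_mem_edge_exps by blast
    then have "Var i * Var j \<in> (I :: 'k mpoly set)"
      by (simp add: edge_ideal_eq Var_def mult_single)
    then have "Var i \<otimes>\<^bsub>R\<^esub> Var j \<in> P"
      using f I.I_r_closed[of "Var i * Var j" f] I.Icarr by auto
    then have "Var i \<in> P \<or> Var j \<in> P"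
      using ij by (intro P.I_prime) (auto simp: Var_def)
    then show ?thesis using ij by blast
  qed
  then show ?thesis by (auto simp: vertex_cover_def)
qed

text \<open>Some term g of f is not in I, but multiplying it by any variable of P lands in I. For v
  this produces an edge from v to some u in the support of g. Multiplying by u leaves the support
  unchanged, so the variable of u is not in P.\<close>

lemma associated_neighbour:
  assumes v: "v \<in> V" "Var v \<in> P"
  obtains u where "{v, u} \<in> E" "Var u \<notin> P"
proof -
  interpret P: primeideal P R by (rule associated_prime)
  obtain f where f: "f \<in> carrier R" "P = {r \<in> carrier R. r \<otimes>\<^bsub>R\<^esub> f \<in> I}"
    using P unfolding associated_primes_def by blast
  have "1 \<notin> P" using P.I_notcarr P.one_imp_carrier by auto
  then have "f \<notin> I" using f by auto
  then obtain g where g: "g \<in> Poly_Mapping.keys f" "g \<notin> edge_exps 1" by (auto simp: edge_ideal_eq)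
  have gV: "Poly_Mapping.keys g \<subseteq> V" using f(1) g(1) by auto
  have *: "Poly_Mapping.single x 1 + g \<in> edge_exps 1" if "Var x \<in> P" for x
  proof -
    have "Var x * f \<in> I" using that f by auto
    then show ?thesis using g(1) by (auto simp: Var_def keys_single_mult edge_ideal_eq)
  qed
  obtain i j where ij: "{i, j} \<in> E" "{i, j} \<subseteq> insert v (Poly_Mapping.keys g)"
    using *[OF v(2)] unfolding edge_exps_1 keys_plus_nat by auto
  have "\<not> {i, j} \<subseteq> Poly_Mapping.keys g" using g(2) ij(1) gV unfolding edge_exps_1 by blast
  then obtain u where u: "{v, u} \<in> E" "u \<in> Poly_Mapping.keys g"
    using ij edge[OF ij(1)] by (auto simp: insert_commute)
  have "Var u \<notin> P"
  proof
    assume "Var u \<in> P"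
    then have "Poly_Mapping.single u 1 + g \<in> edge_exps 1" by (rule *)
    moreover have "Poly_Mapping.keys (Poly_Mapping.single u 1 + g) = Poly_Mapping.keys g"
      using u(2) by (auto simp: keys_plus_nat)
    ultimately show False using g(2) unfolding edge_exps_1 by metis
  qed
  then show thesis using that u(1) by blast
qed

text \<open>Locally at P a variable outside P is a unit, so by \<open>associated_neighbour\<close>
  each variable in P is an edge up to a unit. Every factor of m taken from P thus supplies one edge,
  and s collects the units.\<close>

lemma associated_monomial:
  assumes "Poly_Mapping.keys m \<subseteq> V" "d \<le> (\<Sum>v | v \<in> V \<and> Var v \<in> P. Poly_Mapping.lookup m v)"
  shows "\<exists>s. Poly_Mapping.keys s \<subseteq> V \<and> Poly_Mapping.single s 1 \<notin> P \<and> s + m \<in> edge_exps d"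
  using assms
proof (induction d arbitrary: m)
  interpret P: primeideal P R by (rule associated_prime)
  case 0
  have "1 \<notin> P" using P.I_notcarr P.one_imp_carrier by auto
  then show ?case using 0 by (intro exI[of _ 0]) auto
next
  interpret P: primeideal P R by (rule associated_prime)
  case (Suc d)
  let ?W = "{v \<in> V. Var v \<in> P}"
  have "(\<Sum>v\<in>?W. Poly_Mapping.lookup m v) \<noteq> 0" using Suc.prems(2) by simp
  then obtain v where v: "v \<in> ?W" "Poly_Mapping.lookup m v \<noteq> 0" by (meson sum.neutral)
  obtain u where u: "{v, u} \<in> E" "Var u \<notin> P" using associated_neighbour v by blast
  let ?m = "m - Poly_Mapping.single v 1"
  have m: "m = Poly_Mapping.single v 1 + ?m"
    using v(2) by (intro poly_mapping_eqI) (auto simp: lookup_add lookup_minus lookup_single when_def)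
  have "(\<Sum>x\<in>?W. Poly_Mapping.lookup m x)
      = (\<Sum>x\<in>?W. (if x = v then 1 else 0) + Poly_Mapping.lookup ?m x)"
    using v(2) by (intro sum.cong) (auto simp: lookup_minus lookup_single when_def)
  then have "(\<Sum>x\<in>?W. Poly_Mapping.lookup m x) = 1 + (\<Sum>x\<in>?W. Poly_Mapping.lookup ?m x)"
    using v(1) finite_V by (simp add: sum.distrib)
  then have "d \<le> (\<Sum>x\<in>?W. Poly_Mapping.lookup ?m x)" using Suc.prems(2) by linarith
  moreover have "Poly_Mapping.keys ?m \<subseteq> V"
    using Suc.prems(1) by (auto simp: in_keys_iff lookup_minus)
  ultimately obtain s where s: "Poly_Mapping.keys s \<subseteq> V" "Poly_Mapping.single s 1 \<notin> P" "s + ?m \<in> edge_exps d"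
    using Suc.IH by blast
  let ?s = "Poly_Mapping.single u 1 + s"
  have uV: "u \<in> V" using edge u(1) by blast
  have "Var u \<otimes>\<^bsub>R\<^esub> Poly_Mapping.single s 1 \<notin> P"
    using P.I_prime[of "Var u" "Poly_Mapping.single s 1"] u s uV by (auto simp: Var_def)
  then have "Poly_Mapping.single ?s 1 \<notin> P" by (simp add: Var_def mult_single)
  moreover have "?s + m = Poly_Mapping.single v 1 + Poly_Mapping.single u 1 + (s + ?m)"
    by (subst m) (simp only: ac_simps)
  then have "?s + m \<in> edge_exps (Suc d)" using u(1) s(3) by (auto simp: edge_exps_Suc)
  ultimately show ?case using s(1) uV by (intro exI[of _ ?s]) (simp add: keys_plus_nat)
qed

end

text \<open>Each minimal cover yields an associated prime, and cancelling an element outside it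
  bounds the weights from below. Conversely, the variables in any associated prime form a cover,
  whose weight supplies t edges.\<close>

lemma symbolic_power_edge_ideal:
  "symbolic_power R I t = {p :: 'k::field mpoly. Poly_Mapping.keys p \<subseteq>
    {m. Poly_Mapping.keys m \<subseteq> V \<and> (\<forall>W. vertex_cover W \<longrightarrow> t \<le> (\<Sum>v\<in>W. Poly_Mapping.lookup m v))}}"
    (is "_ = {p. _ p \<subseteq> ?C}")
proof -
  let ?A = "{p :: 'k mpoly. \<forall>m\<in>Poly_Mapping.keys p. Poly_Mapping.keys m \<subseteq> V}"
  let ?Q = "{p :: 'k mpoly. Poly_Mapping.keys p \<subseteq> edge_exps t}"
  have Q: "ideal ?Q (subring_of_type ?A)"
    using ideal_edge_exps unfolding mpoly_ring_def .
  have mem: "f \<in> symbolic_power R I t \<longleftrightarrow>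
    f \<in> ?A \<and> (\<forall>P\<in>associated_primes R I. \<exists>s\<in>?A - P. s * f \<in> ?Q)" for f :: "'k mpoly"
  proof -
    have loc: "Fract f 1 \<in> Idl\<^bsub>localization R P\<^esub> ((\<lambda>g. Fract g 1) ` (I [^]\<^bsub>ideals_set R\<^esub> t))
        \<longleftrightarrow> (\<exists>s\<in>?A - P. s * f \<in> ?Q)" if "f \<in> ?A" "P \<in> associated_primes R I" for P
    proof -
      have "primeideal P (subring_of_type ?A)"
        using associated_prime[OF that(2)] unfolding mpoly_ring_def .
      from mem_localized_ideal_iff[OF this Q that(1)] show ?thesis
        unfolding edge_ideal_power by (simp only: mpoly_ring_def)
    qed
    have "carrier R = ?A" by simp
    then have "f \<in> symbolic_power R I t \<longleftrightarrow> f \<in> ?A \<and> (\<forall>P\<in>associated_primes R I.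
        Fract f 1 \<in> Idl\<^bsub>localization R P\<^esub> ((\<lambda>g. Fract g 1) ` (I [^]\<^bsub>ideals_set R\<^esub> t)))"
      by (simp only: symbolic_power_def mem_Collect_eq)
    also have "\<dots> \<longleftrightarrow> f \<in> ?A \<and> (\<forall>P\<in>associated_primes R I. \<exists>s\<in>?A - P. s * f \<in> ?Q)"
      by (intro conj_cong ball_cong refl loc)
    finally show ?thesis .
  qed
  show ?thesis
  proof (intro Set.set_eqI iffI)
    fix f :: "'k mpoly"
    assume f: "f \<in> symbolic_power R I t"
    have "t \<le> (\<Sum>v\<in>W. Poly_Mapping.lookup m v)" if m: "m \<in> Poly_Mapping.keys f" and W: "vertex_cover W" for m W
    proof -
      obtain W' where W': "W' \<subseteq> W" "vertex_cover W'"
        "\<And>v. v \<in> W' \<Longrightarrow> \<exists>u. {v, u} \<in> E \<and> u \<in> V - W'" using minimal_cover[OF W] by blast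
      let ?P = "{p :: 'k mpoly. Poly_Mapping.keys p \<subseteq> {m. Poly_Mapping.keys m \<subseteq> V \<and> Poly_Mapping.keys m \<inter> W' \<noteq> {}}}"
      let ?w = "\<lambda>m. \<Sum>v\<in>W'. Poly_Mapping.lookup m v"
      have "?P \<in> associated_primes R I" using W' by (intro minimal_cover_associated)
      with f obtain s where s: "s \<in> ?A - ?P" "s * f \<in> ?Q" unfolding mem by meson
      then obtain m\<^sub>0 where m0: "m\<^sub>0 \<in> Poly_Mapping.keys s" "Poly_Mapping.keys m\<^sub>0 \<inter> W' = {}" by auto
      have "t \<le> ?w m"
      proof (rule weight_ge_of_mult[of ?w])
        show "?w m\<^sub>0 = 0" using m0(2) by (intro sum.neutral ballI) (auto simp: in_keys_iff)
        show "\<And>k. k \<in> Poly_Mapping.keys (s * f) \<Longrightarrow> t \<le> ?w k"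
          using s(2) edge_exps_cover[OF W'(2)] by blast
      qed (use m m0 in \<open>simp_all add: lookup_add sum.distrib\<close>)
      also have "\<dots> \<le> (\<Sum>v\<in>W. Poly_Mapping.lookup m v)"
        using W' finite_cover[OF W] by (intro sum_mono2) auto
      finally show ?thesis .
    qed
    moreover have "f \<in> ?A" using f unfolding mem by (rule conjunct1)
    ultimately show "f \<in> {p. Poly_Mapping.keys p \<subseteq> ?C}" by auto
  next
    fix f :: "'k mpoly"
    assume f: "f \<in> {p. Poly_Mapping.keys p \<subseteq> ?C}"
    have "\<exists>s\<in>?A - P. s * f \<in> ?Q" if P: "P \<in> associated_primes R I" for P
    proof -
      \<comment> \<open>Different monomials of f may need different multipliers s;
        \<open>ideal_saturation\<close> combines them into one.\<close>
      have "f \<in> {f \<in> ?A. \<exists>s\<in>?A - P. s * f \<in> ?Q}"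
      proof (rule mem_ideal_if_monomials_mem[of _ V])
        show "ideal {f \<in> ?A. \<exists>s\<in>?A - P. s * f \<in> ?Q} R"
          using associated_prime[OF P] unfolding mpoly_ring_def by (rule ideal_saturation[OF _ Q])
        fix m assume "m \<in> Poly_Mapping.keys f"
        then have "m \<in> ?C" using f by blast
        then obtain s where s: "Poly_Mapping.keys s \<subseteq> V" "Poly_Mapping.single s 1 \<notin> P" "s + m \<in> edge_exps t"
          using associated_monomial[OF P, of m t] associated_cover[OF P] by auto
        have 1: "Poly_Mapping.single s 1 \<in> ?A - P" using s by auto
        have 2: "Poly_Mapping.single s 1 * Poly_Mapping.single m 1 \<in> ?Q"
          using s(3) by (simp add: mult_single)
        have "Poly_Mapping.single m 1 \<in> ?A" using \<open>m \<in> ?C\<close> by auto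
        with 1 2 show "Poly_Mapping.single m 1 \<in> {f \<in> ?A. \<exists>s\<in>?A - P. s * f \<in> ?Q}"
          by (intro CollectI conjI bexI[of _ "Poly_Mapping.single s 1"]) simp_all
      qed
      then show ?thesis unfolding mem_Collect_eq by (rule conjunct2)
    qed
    moreover have "f \<in> ?A" using f by auto
    ultimately show "f \<in> symbolic_power R I t" unfolding mem by (intro conjI ballI)
  qed
qed

end


section \<open>Odd cycles\<close>

lemma mem_cycle_vertices [simp]: "v \<in> cycle_vertices N \<longleftrightarrow> v \<in> {1..N}"
  by (simp add: cycle_vertices_def)

lemma cycle_edges_eq: "N \<ge> 1 \<Longrightarrow> cycle_edges N = (\<lambda>i. {i, cyc_succ N i}) ` {1..N}"
proof -
  assume "N \<ge> 1"
  then have "{1..N} = insert N {1..<N}" by auto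
  moreover have "(\<lambda>i. {i, cyc_succ N i}) ` {1..<N} = (\<lambda>i. {i, i + 1}) ` {1..<N}"
    by (intro image_cong) (auto simp: cyc_succ_def)
  moreover have "{{j, j + 1} | j. 1 \<le> j \<and> j \<le> N - 1} = (\<lambda>i. {i, i + 1}) ` {j. 1 \<le> j \<and> j \<le> N - 1}"
    by blast
  moreover have "{j. 1 \<le> j \<and> j \<le> N - 1} = {1..<N}" using \<open>N \<ge> 1\<close> by auto
  ultimately show ?thesis by (simp add: cycle_edges_def cyc_succ_def)
qed

lemma simple_graph_cycle:
  assumes "N \<ge> 3"
  shows "simple_graph (cycle_vertices N) (cycle_edges N)"
proof
  show "finite (cycle_vertices N)" by (simp add: cycle_vertices_def)
  fix e assume "e \<in> cycle_edges N"
  then obtain i where "i \<in> {1..N}" "e = {i, cyc_succ N i}"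
    using assms by (auto simp: cycle_edges_eq)
  then show "\<exists>i\<in>cycle_vertices N. \<exists>j\<in>cycle_vertices N. i \<noteq> j \<and> e = {i, j}"
    using assms by (intro bexI[of _ i] bexI[of _ "cyc_succ N i"]) (auto simp: cyc_succ_def)
qed

text \<open>Stars and bars, through the list of the values at 1, ..., N. Vanishing elsewhere makes a
  function determined by this list.\<close>

lemma card_fun_sum:
  "card {z. sum z {1..N} = k \<and> (\<forall>v. v \<notin> {1..N} \<longrightarrow> z v = (0::nat))} = multichoose N k"
proof -
  let ?Z = "{z. sum z {1..N} = k \<and> (\<forall>v. v \<notin> {1..N} \<longrightarrow> z v = (0::nat))}"
  have "bij_betw (\<lambda>z. map z [1..<Suc N]) ?Z {l. length l = N \<and> sum_list l = k}"
  proof (rule bij_betw_byWitness[of _ "\<lambda>l v. if v \<in> {1..N} then l ! (v - 1) else 0"])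
    show "\<forall>z\<in>?Z. (\<lambda>v. if v \<in> {1..N} then map z [1..<Suc N] ! (v - 1) else 0) = z"
      by (auto simp: fun_eq_iff simp del: upt_Suc)
    show "\<forall>l\<in>{l. length l = N \<and> sum_list l = k}.
        map (\<lambda>v. if v \<in> {1..N} then l ! (v - 1) else 0) [1..<Suc N] = l"
      by (auto intro!: nth_equalityI simp del: upt_Suc)
    show "(\<lambda>z. map z [1..<Suc N]) ` ?Z \<subseteq> {l. length l = N \<and> sum_list l = k}"
      by (auto simp: interv_sum_list_conv_sum_set_nat atLeastLessThanSuc_atLeastAtMost simp del: upt_Suc)
    show "(\<lambda>l v. if v \<in> {1..N} then l ! (v - 1) else 0) ` {l. length l = N \<and> sum_list l = k} \<subseteq> ?Z"
    proof clarify
      fix l :: "nat list"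
      have "(\<Sum>v = 1..length l. if v \<in> {1..length l} then l ! (v - 1) else 0) = (\<Sum>i<length l. l ! i)"
        by (rule sum.reindex_bij_witness[of _ Suc "\<lambda>v. v - 1"]) auto
      also have "\<dots> = sum_list l" by (simp add: sum_list_sum_nth atLeast0LessThan)
      finally show "(\<Sum>v = 1..length l. if v \<in> {1..length l} then l ! (v - 1) else 0) = sum_list l
        \<and> (\<forall>v. v \<notin> {1..length l} \<longrightarrow> (if v \<in> {1..length l} then l ! (v - 1) else 0) = 0)" by simp
    qed
  qed
  then have "card ?Z = card {l::nat list. length l = N \<and> sum_list l = k}" by (rule bij_betw_same_card)
  then show ?thesis
    using card_length_sum_list[of N k] by (simp add: multichoose_def add.commute)
qed

locale odd_cycle =
  fixes n N :: nat
  assumes n: "n \<ge> 1" and N: "N = 2 * n + 1"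
begin

sublocale simple_graph "cycle_vertices N" "cycle_edges N"
  using n N by (intro simple_graph_cycle) simp

lemma vertex_cover_cycle: "vertex_cover W \<longleftrightarrow> cycle_cover N W"
proof -
  have "cycle_edges N = (\<lambda>i. {i, cyc_succ N i}) ` {1..N}" using N by (intro cycle_edges_eq) simp
  then show ?thesis
    unfolding vertex_cover_def cycle_cover_def by (auto simp: subset_iff)
qed

definition deg :: "(nat \<Rightarrow>\<^sub>0 nat) \<Rightarrow> nat" where
  "deg m = (\<Sum>v\<in>{1..N}. Poly_Mapping.lookup m v)"

lemma deg_add: "deg (a + b) = deg a + deg b"
  by (simp add: deg_def lookup_add sum.distrib)

lemma deg_single: "i \<in> {1..N} \<Longrightarrow> deg (Poly_Mapping.single i 1) = 1"
  by (simp add: deg_def lookup_single when_def)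

lemma edge_exps_degree: "m \<in> edge_exps k \<Longrightarrow> 2 * k \<le> deg m"
proof (induction k arbitrary: m)
  case (Suc k)
  then obtain i j m' where m: "m = Poly_Mapping.single i 1 + Poly_Mapping.single j 1 + m'"
    "{i, j} \<in> cycle_edges N" "m' \<in> edge_exps k" by (auto simp: edge_exps_Suc)
  then have "i \<in> {1..N}" "j \<in> {1..N}" using edge[OF m(2)] by simp_all
  then have "deg m = 2 + deg m'" unfolding m(1) deg_add by (simp only: deg_single)
  then show ?case using Suc.IH[OF m(3)] by simp
qed simp

text \<open>Lowering z at an index i with \<open>z i > 0\<close> lowers the load exactly at the two
  ends of edge i, just as splitting that edge off m lowers the exponents.\<close>

lemma mem_edge_exps_if_load:
  assumes "Poly_Mapping.keys m \<subseteq> cycle_vertices N"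
    and "\<And>v. v \<in> {1..N} \<Longrightarrow> z v + z (cyc_pred N v) \<le> Poly_Mapping.lookup m v"
    and "k \<le> sum z {1..N}"
  shows "m \<in> edge_exps k"
  using assms
proof (induction k arbitrary: m z)
  case 0
  then show ?case by simp
next
  case (Suc k)
  have "sum z {1..N} \<noteq> 0" using Suc.prems(3) by linarith
  then obtain i where i: "i \<in> {1..N}" "z i \<noteq> 0" by (meson sum.neutral)
  let ?j = "cyc_succ N i"
  let ?e = "Poly_Mapping.single i 1 + Poly_Mapping.single ?j (1::nat)"
  let ?z = "z(i := z i - 1)"
  have ij: "i \<noteq> ?j" "?j \<in> {1..N}" "cyc_pred N ?j = i" "cyc_pred N i \<noteq> i"
    using i(1) n N by (auto simp: cyc_succ_def cyc_pred_def)
  have pred: "cyc_pred N v = i \<longleftrightarrow> v = ?j" if "v \<in> {1..N}" for v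
    using i(1) that by (auto simp: cyc_succ_def cyc_pred_def)
  have ge: "1 \<le> Poly_Mapping.lookup m i" "1 \<le> Poly_Mapping.lookup m ?j"
    using Suc.prems(2)[OF i(1)] Suc.prems(2)[OF ij(2)] i ij by auto
  have m: "m = ?e + (m - ?e)"
    using ge ij(1) by (intro poly_mapping_eqI) (auto simp: lookup_add lookup_minus lookup_single when_def)
  have "m - ?e \<in> edge_exps k"
  proof (rule Suc.IH)
    show "Poly_Mapping.keys (m - ?e) \<subseteq> cycle_vertices N"
      using Suc.prems(1) by (auto simp: in_keys_iff lookup_minus)
    fix v assume v: "v \<in> {1..N}"
    show "?z v + ?z (cyc_pred N v) \<le> Poly_Mapping.lookup (m - ?e) v"
      using Suc.prems(2)[OF v] pred[OF v] i(2) ij ge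
      by (auto simp: lookup_minus lookup_add lookup_single when_def)
  next
    have "sum z {1..N} = z i + sum z ({1..N} - {i})" "sum ?z {1..N} = ?z i + sum ?z ({1..N} - {i})"
      by (rule sum.remove[OF finite_atLeastAtMost i(1)])+
    moreover have "sum ?z ({1..N} - {i}) = sum z ({1..N} - {i})" by (intro sum.cong) auto
    moreover have "?z i = z i - 1" by simp
    ultimately show "k \<le> sum ?z {1..N}" using Suc.prems(3) i(2) by linarith
  qed
  moreover have "{i, ?j} \<in> cycle_edges N" using i(1) N by (simp add: cycle_edges_eq)
  ultimately have "?e + (m - ?e) \<in> edge_exps (Suc k)" unfolding edge_exps_Suc by blast
  then show ?case by (subst m)
qed

text \<open>The exponent vector of \<open>x\<^sub>1 \<cdots> x\<^sub>N\<close> times the edges with multiplicities \<open>z\<close>.\<close>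

definition gen_exp :: "(nat \<Rightarrow> nat) \<Rightarrow> nat \<Rightarrow>\<^sub>0 nat" where
  "gen_exp z = (\<Sum>v\<in>{1..N}. Poly_Mapping.single v (1 + z v + z (cyc_pred N v)))"

lemma lookup_gen_exp:
  "Poly_Mapping.lookup (gen_exp z) v = (if v \<in> {1..N} then 1 + z v + z (cyc_pred N v) else 0)"
proof -
  have "Poly_Mapping.lookup (gen_exp z) v = (\<Sum>x\<in>{1..N}. if x = v then 1 + z x + z (cyc_pred N x) else 0)"
    unfolding gen_exp_def lookup_sum by (intro sum.cong) (simp_all add: lookup_single when_def)
  then show ?thesis by simp
qed

definition gen_exps :: "nat \<Rightarrow> (nat \<Rightarrow>\<^sub>0 nat) set" where
  "gen_exps k = gen_exp ` {z. sum z {1..N} = k \<and> (\<forall>v. v \<notin> {1..N} \<longrightarrow> z v = 0)}"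

lemma card_gen_exps: "card (gen_exps k) = multichoose N k"
proof -
  have "inj_on gen_exp {z. sum z {1..N} = k \<and> (\<forall>v. v \<notin> {1..N} \<longrightarrow> z v = 0)}"
  proof (rule inj_onI, rule ext)
    fix z z' :: "nat \<Rightarrow> nat" and i
    assume zero: "z \<in> {z. sum z {1..N} = k \<and> (\<forall>v. v \<notin> {1..N} \<longrightarrow> z v = 0)}"
      "z' \<in> {z. sum z {1..N} = k \<and> (\<forall>v. v \<notin> {1..N} \<longrightarrow> z v = 0)}"
      and eq: "gen_exp z = gen_exp z'"
    have "z v + z (cyc_pred N v) = z' v + z' (cyc_pred N v)" if "v \<in> {1..N}" for v
      using arg_cong[OF eq, of "\<lambda>m. Poly_Mapping.lookup m v"] that by (simp add: lookup_gen_exp)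
    then have "z i = z' i" if "i \<in> {1..N}"
      using that N by (intro odd_cycle_load_inj[of N z z']) auto
    then show "z i = z' i" using zero by (cases "i \<in> {1..N}") auto
  qed
  then show ?thesis unfolding gen_exps_def using card_fun_sum[of N k] by (simp only: card_image)
qed

text \<open>For k = t - n - 1 this is 2t - 1.\<close>

lemma gen_exps_degree:
  assumes "m \<in> gen_exps k"
  shows "deg m = N + 2 * k"
proof -
  obtain z where z: "m = gen_exp z" "sum z {1..N} = k" using assms by (auto simp: gen_exps_def)
  have "deg m = (\<Sum>v\<in>{1..N}. 1 + z v + z (cyc_pred N v))"
    unfolding z(1) deg_def by (intro sum.cong) (auto simp: lookup_gen_exp)
  also have "\<dots> = N + 2 * k"
    unfolding sum.distrib using sum_cyc_pred[of N z] z(2) N by simp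
  finally show ?thesis .
qed

lemma cover_exps_eq:
  assumes t: "n + 1 \<le> t" "t \<le> N"
  shows "{m. Poly_Mapping.keys m \<subseteq> cycle_vertices N \<and>
      (\<forall>W. vertex_cover W \<longrightarrow> t \<le> (\<Sum>v\<in>W. Poly_Mapping.lookup m v))}
    = edge_exps t \<union> gen_exps (t - n - 1)" (is "?C = _")
proof (intro equalityI subsetI)
  fix m assume "m \<in> ?C"
  then have mV: "Poly_Mapping.keys m \<subseteq> cycle_vertices N"
    and cov: "\<And>W. cycle_cover N W \<Longrightarrow> t \<le> sum (Poly_Mapping.lookup m) W"
    by (auto simp: vertex_cover_cycle)
  show "m \<in> edge_exps t \<union> gen_exps (t - n - 1)"
  proof (cases "2 * t \<le> sum (Poly_Mapping.lookup m) {1..N}")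
    case True
    have "\<exists>z. (\<forall>v\<in>{1..N}. z v + z (cyc_pred N v) \<le> Poly_Mapping.lookup m v) \<and> t \<le> sum z {1..N}"
      using n N by (intro cycle_matching cov True) simp_all
    then obtain z where "\<forall>v\<in>{1..N}. z v + z (cyc_pred N v) \<le> Poly_Mapping.lookup m v" "t \<le> sum z {1..N}"
      by (elim exE conjE)
    then have "m \<in> edge_exps t" by (intro mem_edge_exps_if_load[OF mV, of z]) auto
    then show ?thesis by simp
  next
    case False
    have "2 * t \<le> sum (Poly_Mapping.lookup m) {1..N} + 1"
      by (rule odd_cycle_weight[OF N]) fact+
    with False have "sum (Poly_Mapping.lookup m) {1..N} + 1 = 2 * t" by linarith
    have "\<exists>z. (\<forall>v\<in>{1..N}. Poly_Mapping.lookup m v = 1 + z v + z (cyc_pred N v)) \<and> sum z {1..N} + n + 1 = t"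
      by (rule odd_cycle_tight[OF N cov \<open>_ = 2 * t\<close>])
    then obtain z where
      z: "\<forall>v\<in>{1..N}. Poly_Mapping.lookup m v = 1 + z v + z (cyc_pred N v)" "sum z {1..N} + n + 1 = t"
      by (elim exE conjE)
    \<comment> \<open>\<open>odd_cycle_tight\<close> leaves z free outside \<open>{1..N}\<close>,
      whereas \<open>gen_exps\<close> uses functions that vanish there.\<close>
    let ?z = "\<lambda>v. if v \<in> {1..N} then z v else 0"
    have "m = gen_exp ?z"
    proof (rule poly_mapping_eqI)
      fix v
      show "Poly_Mapping.lookup m v = Poly_Mapping.lookup (gen_exp ?z) v"
      proof (cases "v \<in> {1..N}")
        case True
        then have "cyc_pred N v \<in> {1..N}" by (auto simp: cyc_pred_def)
        with True show ?thesis using bspec[OF z(1) True] by (simp add: lookup_gen_exp)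
      next
        case False
        then have "v \<notin> Poly_Mapping.keys m" using mV by auto
        then show ?thesis using False by (simp add: lookup_gen_exp in_keys_iff)
      qed
    qed
    moreover have "sum ?z {1..N} = sum z {1..N}" by (intro sum.cong) auto
    then have "sum ?z {1..N} = t - n - 1" using z(2) by linarith
    ultimately have "m \<in> gen_exps (t - n - 1)" unfolding gen_exps_def by (intro image_eqI[of _ _ ?z] CollectI conjI) simp_all
    then show ?thesis by simp
  qed
next
  fix m assume "m \<in> edge_exps t \<union> gen_exps (t - n - 1)"
  then show "m \<in> ?C"
  proof
    assume "m \<in> edge_exps t"
    then show ?thesis by (intro CollectI conjI allI impI edge_exps_subset edge_exps_cover)
  next
    assume "m \<in> gen_exps (t - n - 1)"
    then obtain z where z: "m = gen_exp z" "sum z {1..N} = t - n - 1" by (auto simp: gen_exps_def)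
    have "t \<le> (\<Sum>v\<in>W. Poly_Mapping.lookup m v)" if "vertex_cover W" for W
    proof -
      have W: "cycle_cover N W" using that by (simp add: vertex_cover_cycle)
      then have "W \<subseteq> {1..N}" by (simp add: cycle_cover_def)
      \<comment> \<open>A vertex meets two edges, so a cover has at least n + 1 vertices. The factor
        \<open>x_1 ... x_N\<close> contributes \<open>card W\<close>, and the t - n - 1 edges supply
        the rest of t.\<close>
      have "N \<le> 2 * card W" using cycle_cover_load[OF W, of "\<lambda>_. 1"] by simp
      then have "t \<le> card W + (t - n - 1)" using t N by linarith
      also have "\<dots> \<le> (\<Sum>v\<in>W. 1) + (\<Sum>v\<in>W. z v + z (cyc_pred N v))"
        using cycle_cover_load[OF W, of z] z(2) by simp
      also have "\<dots> = (\<Sum>v\<in>W. Poly_Mapping.lookup m v)"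
        unfolding sum.distrib[symmetric] z(1)
        using \<open>W \<subseteq> {1..N}\<close> by (intro sum.cong) (auto simp: lookup_gen_exp)
      finally show ?thesis .
    qed
    moreover have "Poly_Mapping.keys m \<subseteq> cycle_vertices N"
      by (auto simp: in_keys_iff z(1) lookup_gen_exp split: if_splits)
    ultimately show ?thesis by (intro CollectI conjI allI impI)
  qed
qed

lemma sdefect_odd_cycle:
  assumes t: "n + 1 \<le> t" "t \<le> N"
  shows "sdefect (mpoly_ring (cycle_vertices N) :: ('k::field) mpoly ring)
    (edge_ideal (cycle_vertices N) (cycle_edges N)) t = multichoose N (t - n - 1)"
proof -
  let ?M = "edge_exps t" and ?G = "gen_exps (t - n - 1)"
  have C: "m \<in> ?M \<union> ?G \<longleftrightarrow> Poly_Mapping.keys m \<subseteq> cycle_vertices N \<and>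
      (\<forall>W. vertex_cover W \<longrightarrow> t \<le> (\<Sum>v\<in>W. Poly_Mapping.lookup m v))" for m
    unfolding cover_exps_eq[OF t, symmetric] by simp
  have dG: "deg m + 1 = 2 * t" if "m \<in> ?G" for m using gen_exps_degree[OF that] t N by linarith
  have dM: "2 * t \<le> deg m" if "m \<in> ?M" for m using edge_exps_degree[OF that] .
  have GV: "Poly_Mapping.keys m \<subseteq> cycle_vertices N" if "m \<in> ?G" for m
    using C[THEN iffD1, OF UnI2[OF that]] by (rule conjunct1)
  \<comment> \<open>An infinite set would have \<open>card\<close> 0, but this binomial coefficient
    is positive.\<close>
  have fin: "finite ?G"
    using card_gen_exps[of "t - n - 1"] t N by (intro card_ge_0_finite) (simp add: multichoose_def)
  \<comment> \<open>A proper multiple of a generator still satisfies all cover conditions, but its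
    degree exceeds 2t - 1; so it belongs to the other set of the union.\<close>
  have eG: "e + m \<in> ?M"
    if m: "m \<in> ?G" and e: "Poly_Mapping.keys e \<subseteq> cycle_vertices N" "e \<noteq> 0" for m e
  proof -
    have "t \<le> (\<Sum>v\<in>W. Poly_Mapping.lookup (e + m) v)" if "vertex_cover W" for W
    proof -
      have "t \<le> (\<Sum>v\<in>W. Poly_Mapping.lookup m v)"
        using C[THEN iffD1, OF UnI2[OF m]] that by simp
      then show ?thesis by (simp add: lookup_add sum.distrib)
    qed
    moreover have "Poly_Mapping.keys (e + m) \<subseteq> cycle_vertices N"
      using e(1) GV[OF m] by (simp add: keys_plus_nat)
    ultimately have "e + m \<in> ?M \<union> ?G" by (intro C[THEN iffD2] conjI allI impI)
    moreover have "e + m \<notin> ?G"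
    proof
      assume "e + m \<in> ?G"
      then have "deg e = 0" using dG[of m] dG[of "e + m"] m deg_add[of e m] by linarith
      then have "Poly_Mapping.lookup e v = 0" if "v \<in> {1..N}" for v
        using that by (simp add: deg_def)
      then have "e = 0" using e(1)
        by (intro poly_mapping_eqI) (metis in_keys_iff lookup_zero mem_cycle_vertices subsetD)
      with e(2) show False ..
    qed
    ultimately show ?thesis by blast
  qed
  have disj: "?M \<inter> ?G = {}"
  proof (intro equals0I, elim IntE)
    fix m assume "m \<in> ?M" "m \<in> ?G"
    then show False using dG[of m] dM[of m] by simp
  qed
  have up: "e + m \<in> ?M" if "m \<in> ?M" "Poly_Mapping.keys e \<subseteq> cycle_vertices N" for m e
    using edge_exps_add[of e 0 m t] that by simp
  show ?thesis
    unfolding sdefect_def symbolic_power_edge_ideal edge_ideal_power cover_exps_eq[OF t]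
      card_gen_exps[symmetric]
    by (rule card_minimal_monomial_generators[OF edge_exps_subset GV up eG disj fin])
qed

end

theorem theorem5p13:
  fixes n t :: nat and I :: "('k::alg_closed_field) mpoly set"
  assumes "n \<ge> 1"
    and "I = edge_ideal (cycle_vertices (2 * n + 1)) (cycle_edges (2 * n + 1))"
    and "n + 2 \<le> t" and "t \<le> 2 * n + 1"
  shows "sdefect (mpoly_ring (cycle_vertices (2 * n + 1))) I t
           = multichoose (2 * n + 1) (t - n - 1)"
proof -
  interpret odd_cycle n "2 * n + 1" by (rule odd_cycle.intro[OF assms(1) refl])
  have "n + 1 \<le> t" using assms(3) by simp
  then show ?thesis unfolding assms(2) using assms(4) by (rule sdefect_odd_cycle)
qed

end
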